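(* For any positive integers $K$ and $t$ with $(t+1)\mid K$, there always exists an optimal $\left(K,\ \frac{2K-t}{K-t}\binom{K-1}{t},\ \binom{K-1}{t-1},\ \binom{K}{t+1}\right)$ SPDA, which gives a $(K,M,N)$ secure coded caching scheme with $\frac{M}{N}=\frac{K}{2K-t}$, transmission rate $R=\frac{K-t}{t+1}\cdot\frac{K}{2K-t}$ and subpacketization $\frac{2K-t}{K-t}\binom{K-1}{t}$.
   Context: For a positive integer $n$, $[0,n)=\{0,1,\dots,n-1\}$. SPDA. For positive integers $K,F$, an $F\times K$ array $\mathbf{P}=(p_{j,k})_{j\in[0,F),k\in[0,K)}$ with entries in $\{*\}\cup[0,S)$ is a $(K,F,Z,S)$ secure placement delivery array (SPDA) if: (C1) the symbol $*$ appears exactly $Z$ times in each column; (C2) each $s\in[0,S)$ appears at least four times; (C3) for each $s\in[0,S)$, the subarray $\mathbf{P}^{(s)}$ formed by all rows and columns containing $s$ is, up to row and column permutations, a $(g+1)\times g$ array (for some $g$ depending on $s$) whose first row has all entries equal to $s$ and whose remaining $g$ rows form the $g\times g$ array with $s$ on the diagonal and $*$ off the diagonal. For each $s$, let $\mathcal{U}_s$ be the set of columns containing $s$ and let $j^{(s)}$ be the unique row containing $s$ at least twice. A $(K,F,Z,S)$ SPDA is optimal if $S$ is the minimum possible for the given $K,F,Z$. Caching system. A server holds $N$ files $W_0,\dots,W_{N-1}$, independent and uniform on $\{0,1\}^B$ (with $F\mid B$), and serves $K$ users $[0,K)$ over a shared link; each user has a cache for file content of $MB$ bits (the cache space used by keys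 is not counted). User $k$ requests $W_{d_k}$; $\mathbf{d}=(d_0,\dots,d_{K-1})$ is random, independent of everything else, and $\mathbf{d}_{-k}$ is $\mathbf{d}$ with $d_k$ removed. The requested files are assumed to be pairwise different (so $N\ge K$), $\mathbf{d}$ being uniform on such vectors. The scheme given by an SPDA $\mathbf{P}$. The server draws independent uniformly random permutations $\phi_0,\dots,\phi_{N-1}$ of $[0,F)$, known only to itself. Each $W_n$ is split into $F$ packets of $B/F$ bits, the packet in position $j$ carrying the public label $\phi_n(j)$; the labelled packet is written $W_{n,\phi_n(j)}$. User $k$ caches the labelled packets $\mathcal{Z}_k=\{W_{n,\phi_n(j)}: p_{j,k}=*,\ n\in[0,N)\}\cup\{W_{n,\phi_n(j^{(s)})}: p_{j^{(s)},k}=s,\ s\in[0,S),\ n\in[0,N)\}$ and the keys $\mathcal{T}_k=\{T_{\mathcal{U}_s}:k\in\mathcal{U}_s\}$, the keys (one per $s$) being independent and uniform on $\{0,1\}^{B/F}$. Let $\mathfrak{U}_k=\{\mathcal{U}_s:k\in\mathcal{U}_s\}$. For each $s\in[0,S)$ the server broadcasts $T_{\mathcal{U}_s}\oplus X_{\mathcal{U}_s}$, where $$X_{\mathcal{U}_s}=\Big(\bigoplus_{\substack{k\in\mathcal{U}_s,\ j\ne j^{(s)}\\ p_{j,k}=s}}W_{d_k,\phi_{d_k}(j)}\Big)\oplus\Big(\bigoplus_{n\in[0,N)\setminus\{d_k:\,k\in\mathcal{U}_s\}}W_{n,\phi_n(j^{(s)})}\Big),$$ with a header of negligible length giving $\mathcal{U}_s$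 and the file indices and labels of the packets in $X_{\mathcal{U}_s}$ (in information quantities $X_{\mathcal{U}_s}$ is understood together with this header), and sends $\phi_{d_k}$ privately to user $k$. Such a scheme is a secure coded caching scheme if, for every $k$, $H(W_{d_k}\mid \mathcal{Z}_k,\mathcal{T}_k,\{T_{\mathcal{U}_s}\oplus X_{\mathcal{U}_s}:k\in\mathcal{U}_s\},\phi_{d_k})=0$ (headers included) and $I(\mathbf{d}_{-k};\{X_{\mathcal{U}_s}:k\in\mathcal{U}_s\}\mid\phi_{d_k},\mathcal{Z}_k,d_k,\mathfrak{U}_k)=0$. The rate $R$ is the total number of broadcast bits (excluding headers) divided by $B$; the subpacketization is the number $F$ of packets per file. *)

theory Defs
  imports "HOL-Probability.Information" "HOL-Combinatorics.Permutations"
begin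

section \<open>Secure placement delivery arrays\<close>

text \<open>
  An \<open>F \<times> K\<close> array is a function of a row \<open>j < F\<close> and a column \<open>k < K\<close>; \<^term>\<open>None\<close> stands for
  the symbol \<open>*\<close>. Values outside the index range are irrelevant.
\<close>

type_synonym array = "nat \<Rightarrow> nat \<Rightarrow> nat option"

definition rows_of :: "nat \<Rightarrow> nat \<Rightarrow> array \<Rightarrow> nat \<Rightarrow> nat set" where
  "rows_of K F P s = {j. j < F \<and> (\<exists>k<K. P j k = Some s)}"

definition columns_of :: "nat \<Rightarrow> nat \<Rightarrow> array \<Rightarrow> nat \<Rightarrow> nat set" where
  "columns_of K F P s = {k. k < K \<and> (\<exists>j<F. P j k = Some s)}"

definition spda :: "nat \<Rightarrow> nat \<Rightarrow> nat \<Rightarrow> nat \<Rightarrow> array \<Rightarrow> bool" where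
  "spda K F Z S P \<longleftrightarrow>
     0 < K \<and> 0 < F \<and>
     (\<forall>j<F. \<forall>k<K. \<forall>s. P j k = Some s \<longrightarrow> s < S) \<and>
     (\<forall>k<K. card {j. j < F \<and> P j k = None} = Z) \<and>
     (\<forall>s<S. 4 \<le> card {(j, k). j < F \<and> k < K \<and> P j k = Some s}) \<and>
     (\<forall>s<S. \<exists>(g::nat) r c.
        bij_betw r {..<g + 1} (rows_of K F P s) \<and>
        bij_betw c {..<g} (columns_of K F P s) \<and>
        (\<forall>i<g. P (r 0) (c i) = Some s) \<and>
        (\<forall>i<g. \<forall>i'<g. P (r (i + 1)) (c i') = (if i = i' then Some s else None)))"

definition optimal_spda :: "nat \<Rightarrow> nat \<Rightarrow> nat \<Rightarrow> nat \<Rightarrow> array \<Rightarrow> bool" where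
  "optimal_spda K F Z S P \<longleftrightarrow>
     spda K F Z S P \<and> (\<forall>S' P'. spda K F Z S' P' \<longrightarrow> S \<le> S')"

definition repeated_row :: "nat \<Rightarrow> nat \<Rightarrow> array \<Rightarrow> nat \<Rightarrow> nat" where
  "repeated_row K F P s = (THE j. j < F \<and> 2 \<le> card {k. k < K \<and> P j k = Some s})"


section \<open>The caching scheme of an array\<close>

text \<open>The XOR of bit strings of length \<open>L\<close> is taken bitwise.\<close>

definition xor_bits :: "bool list \<Rightarrow> bool list \<Rightarrow> bool list" where
  "xor_bits = map2 (\<noteq>)"

definition big_xor :: "nat \<Rightarrow> 'i set \<Rightarrow> ('i \<Rightarrow> bool list) \<Rightarrow> bool list" where
  "big_xor L A f = map (\<lambda>i. odd (card {a \<in> A. f a ! i})) [0..<L]"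

text \<open>The joint values of all sources of randomness: \<open>W\<^sub>n\<close>, \<open>\<phi>\<^sub>n\<close>, the keys and \<open>d\<^sub>k\<close>.\<close>

datatype outcome =
  Outcome (file_of: "nat \<Rightarrow> bool list") (label_of: "nat \<Rightarrow> nat \<Rightarrow> nat")
    (key_of: "nat \<Rightarrow> bool list") (demand_of: "nat \<Rightarrow> nat")

type_synonym labelled_packet = "nat \<times> nat \<times> bool list" \<comment> \<open>file index, public label, content\<close>
type_synonym header = "nat set \<times> (nat \<times> nat) set" \<comment> \<open>\<open>\<U>\<^sub>s\<close>, pairs of file index and label\<close>

locale array_caching =
  fixes K F S N B :: nat and P :: array
begin

abbreviation \<U> :: "nat \<Rightarrow> nat set" where "\<U> s \<equiv> columns_of K F P s"
abbreviation rep :: "nat \<Rightarrow> nat" where "rep s \<equiv> repeated_row K F P s"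

text \<open>
  The uniform distribution on this product set is the one under which the files, the permutations,
  the keys and the demand vector are all independent, each uniform on its own range.
\<close>

definition outcomes :: "outcome set" where
  "outcomes = {\<omega>.
     file_of \<omega> \<in> {..<N} \<rightarrow>\<^sub>E {w. length w = B} \<and>
     label_of \<omega> \<in> {..<N} \<rightarrow>\<^sub>E {\<pi>. \<pi> permutes {..<F}} \<and>
     key_of \<omega> \<in> {..<S} \<rightarrow>\<^sub>E {w. length w = B div F} \<and>
     demand_of \<omega> \<in> {..<K} \<rightarrow>\<^sub>E {..<N} \<and> inj_on (demand_of \<omega>) {..<K}}"

definition prob_model :: "outcome measure" where
  "prob_model = uniform_count_measure outcomes"

definition packet :: "nat \<Rightarrow> nat \<Rightarrow> outcome \<Rightarrow> bool list" where
  "packet n j \<omega> = take (B div F) (drop (j * (B div F)) (file_of \<omega> n))"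

text \<open>
  A labelled packet carries its label but not its position \<open>j\<close> in the file, so a cache does not
  reveal the permutations.
\<close>

definition labelled :: "nat \<Rightarrow> nat \<Rightarrow> outcome \<Rightarrow> labelled_packet" where
  "labelled n j \<omega> = (n, label_of \<omega> n j, packet n j \<omega>)"

definition cache :: "nat \<Rightarrow> outcome \<Rightarrow> labelled_packet set" where
  "cache k \<omega> =
     {labelled n j \<omega> | n j. n < N \<and> j < F \<and> P j k = None} \<union>
     {labelled n (rep s) \<omega> | n s. n < N \<and> s < S \<and> P (rep s) k = Some s}"

definition symbols_of :: "nat \<Rightarrow> nat set" where
  "symbols_of k = {s. s < S \<and> k \<in> \<U> s}"

definition user_keys :: "nat \<Rightarrow> outcome \<Rightarrow> nat \<Rightarrow> bool list" where
  "user_keys k \<omega> = restrict (key_of \<omega>) (symbols_of k)"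

definition demanded_cells :: "nat \<Rightarrow> (nat \<times> nat) set" where
  "demanded_cells s = {(k, j). k \<in> \<U> s \<and> j < F \<and> j \<noteq> rep s \<and> P j k = Some s}"

definition other_files :: "nat \<Rightarrow> outcome \<Rightarrow> nat set" where
  "other_files s \<omega> = {..<N} - demand_of \<omega> ` \<U> s"

definition header :: "nat \<Rightarrow> outcome \<Rightarrow> header" where
  "header s \<omega> =
     (\<U> s,
      {(demand_of \<omega> k, label_of \<omega> (demand_of \<omega> k) j) | k j. (k, j) \<in> demanded_cells s} \<union>
      {(n, label_of \<omega> n (rep s)) | n. n \<in> other_files s \<omega>})"

definition X :: "nat \<Rightarrow> outcome \<Rightarrow> bool list" where
  "X s \<omega> = xor_bits
     (big_xor (B div F) (demanded_cells s) (\<lambda>(k, j). packet (demand_of \<omega> k) j \<omega>))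
     (big_xor (B div F) (other_files s \<omega>) (\<lambda>n. packet n (rep s) \<omega>))"

definition broadcast :: "nat \<Rightarrow> outcome \<Rightarrow> bool list" where
  "broadcast s \<omega> = xor_bits (key_of \<omega> s) (X s \<omega>)"

definition received :: "nat \<Rightarrow> outcome \<Rightarrow> nat \<Rightarrow> header \<times> bool list" where
  "received k \<omega> = (\<lambda>s\<in>symbols_of k. (header s \<omega>, broadcast s \<omega>))"

definition unmasked :: "nat \<Rightarrow> outcome \<Rightarrow> nat \<Rightarrow> header \<times> bool list" where
  "unmasked k \<omega> = (\<lambda>s\<in>symbols_of k. (header s \<omega>, X s \<omega>))"

definition user_sets :: "nat \<Rightarrow> nat set set" where
  "user_sets k = \<U> ` symbols_of k"

text \<open>Entropies of discrete random variables, in bits, as in the locale \<^locale>\<open>information_space\<close>.\<close>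

definition cond_entropy :: "(outcome \<Rightarrow> 'a) \<Rightarrow> (outcome \<Rightarrow> 'b) \<Rightarrow> real" where
  "cond_entropy U V =
     prob_space.conditional_entropy prob_model 2
       (count_space (U ` space prob_model)) (count_space (V ` space prob_model)) U V"

definition cond_mutual_info ::
    "(outcome \<Rightarrow> 'a) \<Rightarrow> (outcome \<Rightarrow> 'b) \<Rightarrow> (outcome \<Rightarrow> 'c) \<Rightarrow> real" where
  "cond_mutual_info U V T =
     prob_space.conditional_mutual_information prob_model 2
       (count_space (U ` space prob_model)) (count_space (V ` space prob_model))
       (count_space (T ` space prob_model)) U V T"

definition decodable :: "nat \<Rightarrow> bool" where
  "decodable k \<longleftrightarrow>
     cond_entropy (\<lambda>\<omega>. file_of \<omega> (demand_of \<omega> k))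
       (\<lambda>\<omega>. (cache k \<omega>, user_keys k \<omega>, received k \<omega>, label_of \<omega> (demand_of \<omega> k))) = 0"

definition demand_private :: "nat \<Rightarrow> bool" where
  "demand_private k \<longleftrightarrow>
     cond_mutual_info (\<lambda>\<omega>. restrict (demand_of \<omega>) ({..<K} - {k})) (unmasked k)
       (\<lambda>\<omega>. (label_of \<omega> (demand_of \<omega> k), cache k \<omega>, demand_of \<omega> k, user_sets k)) = 0"

text \<open>\<open>M\<close> counts cached file content, in multiples of the file size \<open>B\<close>.\<close>

definition has_memory :: "real \<Rightarrow> bool" where
  "has_memory M \<longleftrightarrow>
     (\<forall>k<K. \<forall>\<omega>\<in>outcomes. real (\<Sum>(n, l, w)\<in>cache k \<omega>. length w) = M * real B)"

definition secure_coded_caching_scheme :: "real \<Rightarrow> bool" where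
  "secure_coded_caching_scheme M \<longleftrightarrow>
     has_memory M \<and> (\<forall>k<K. decodable k \<and> demand_private k)"

definition has_rate :: "real \<Rightarrow> bool" where
  "has_rate R \<longleftrightarrow>
     (\<forall>\<omega>\<in>outcomes. R = real (\<Sum>s<S. length (broadcast s \<omega>)) / real B)"

end

end

theory Submission
  imports Defs
begin

text \<open>
  The array consists of the rows of the Maddah-Ali--Niesen array (row \<open>T\<close>, column \<open>k\<close> holds
  \<open>*\<close> if \<open>k \<in> T\<close>, and the symbol \<open>T \<union> {k}\<close> otherwise) and of one further star-free row for each
  partition of the columns into \<open>(t + 1)\<close>-sets in a Baranyai factorisation, whose entry in column \<open>k\<close> is
  the block containing \<open>k\<close>.

  For the minimality of \<open>S\<close>, a symbol in \<open>g\<close> columns has \<open>g\<close> cells outside its repeated row, and each of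
  them lies in a row with at least \<open>g - 1\<close> stars. Weighting these cells by \<open>1 / g\<close> and bounding the total
  weight of each row by a linear function of its numbers of stars and of such cells bounds \<open>S\<close> from below.

  Any array with a symbol in every column gives a secure scheme. For privacy, fix two demand
  vectors that agree at user \<open>k\<close>. For each file other than \<open>d\<^sub>k\<close> the packets occurring in the \<open>X\<^sub>s\<close>
  seen by user \<open>k\<close> sit at distinct positions that user \<open>k\<close> caches, so a permutation of the cached
  positions exchanges the positions for the two demand vectors. Applying it to the packets together
  with their labels changes nothing that user \<open>k\<close> sees, and it is a bijection of the outcomes.
\<close>

section \<open>Hall's and Baranyai's theorems\<close>

text \<open>Induction on the size of \<open>I\<close>. If some non-empty proper subfamily
  \<open>J\<close> is tight, it is matched on its own and the rest is matched outside the union of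
  \<open>J\<close>. Otherwise every such subfamily has a spare value, so one choice can be made
  freely and its value deleted.\<close>

theorem hall_marriage:
  assumes "finite I" "\<And>i. i \<in> I \<Longrightarrow> finite (N i)"
    and "\<And>J. J \<subseteq> I \<Longrightarrow> card J \<le> card (\<Union> (N ` J))"
  shows "\<exists>h. inj_on h I \<and> (\<forall>i\<in>I. h i \<in> N i)"
  using assms
proof (induction "card I" arbitrary: I N rule: less_induct)
  case less
  note fin = less.prems(1,2) and hall = less.prems(3)
  show ?case
  proof (cases "\<exists>J. J \<noteq> {} \<and> J \<subset> I \<and> card (\<Union> (N ` J)) \<le> card J")
    case True
    then obtain J where J: "J \<noteq> {}" "J \<subset> I" "card (\<Union> (N ` J)) \<le> card J" by blast
    define U where "U = \<Union> (N ` J)"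
    have finJ: "finite J" using J(2) fin(1) by (meson finite_subset psubset_imp_subset)
    have finU: "finite U" unfolding U_def using finJ J(2) fin(2) by blast
    have "\<exists>h. inj_on h J \<and> (\<forall>i\<in>J. h i \<in> N i)"
    proof (rule less.hyps)
      show "card J < card I" by (rule psubset_card_mono[OF fin(1) J(2)])
      show "finite J" by (rule finJ)
      show "finite (N i)" if "i \<in> J" for i using that J(2) fin(2) by blast
      show "card L \<le> card (\<Union> (N ` L))" if "L \<subseteq> J" for L using that J(2) hall by blast
    qed
    then obtain h where h: "inj_on h J" "\<And>i. i \<in> J \<Longrightarrow> h i \<in> N i" by blast
    have "\<exists>h'. inj_on h' (I - J) \<and> (\<forall>i\<in>I - J. h' i \<in> N i - U)"
    proof (rule less.hyps)
      show "card (I - J) < card I"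
        using J(1,2) fin(1) by (intro psubset_card_mono) auto
      show "finite (I - J)" using fin(1) by simp
      show "finite (N i - U)" if "i \<in> I - J" for i using that fin(2) by blast
      show "card L \<le> card (\<Union>i\<in>L. N i - U)" if L: "L \<subseteq> I - J" for L
      proof -
        have finL: "finite L" using L fin(1) by (meson finite_Diff finite_subset)
        have finV: "finite (\<Union>i\<in>L. N i - U)" using finL L fin(2) by blast
        \<comment> \<open>Deleting \<open>U\<close> keeps Hall's condition: the condition for
          \<open>L \<union> J\<close> loses \<open>card U\<close>, which is at most
          \<open>card J\<close>.\<close>
        have "card L + card J = card (L \<union> J)"
          using L finL finJ by (subst card_Un_disjoint) auto
        also have "\<dots> \<le> card (\<Union> (N ` (L \<union> J)))" by (rule hall) (use L J(2) in blast)
        also have "\<Union> (N ` (L \<union> J)) = (\<Union>i\<in>L. N i - U) \<union> U" unfolding U_def by blast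
        also have "card \<dots> = card (\<Union>i\<in>L. N i - U) + card U"
          using finV finU by (intro card_Un_disjoint) auto
        finally show ?thesis using J(3) unfolding U_def by linarith
      qed
    qed
    then obtain h' where h': "inj_on h' (I - J)" "\<And>i. i \<in> I - J \<Longrightarrow> h' i \<in> N i - U" by blast
    define g where "g i = (if i \<in> J then h i else h' i)" for i
    have "inj_on g I"
    proof (rule inj_onI)
      fix x y assume "x \<in> I" "y \<in> I" "g x = g y"
      moreover have "h a \<noteq> h' b" if "a \<in> J" "b \<in> I - J" for a b
        using h(2)[OF that(1)] h'(2)[OF that(2)] that(1) unfolding U_def by auto
      ultimately show "x = y"
        using inj_onD[OF h(1)] inj_onD[OF h'(1)] unfolding g_def
        by (metis DiffI)
    qed
    moreover have "\<forall>i\<in>I. g i \<in> N i" using h(2) h'(2) unfolding g_def by auto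
    ultimately show ?thesis by blast
  next
    case strict: False
    show ?thesis
    proof (cases "I = {}")
      case True then show ?thesis by simp
    next
      case ne: False
      then obtain a where a: "a \<in> I" by blast
      have "card {a} \<le> card (\<Union> (N ` {a}))" by (rule hall) (use a in simp)
      then obtain x where x: "x \<in> N a" by fastforce
      have "\<exists>h. inj_on h (I - {a}) \<and> (\<forall>i\<in>I - {a}. h i \<in> N i - {x})"
      proof (rule less.hyps)
        show "card (I - {a}) < card I" using a fin(1) by (simp add: card_gt_0_iff ne)
        show "finite (I - {a})" using fin(1) by simp
        show "finite (N i - {x})" if "i \<in> I - {a}" for i using that fin(2) by blast
        show "card L \<le> card (\<Union>i\<in>L. N i - {x})" if L: "L \<subseteq> I - {a}" for L
        proof (cases "L = {}")
          case False
          \<comment> \<open>As a non-empty proper subfamily \<open>L\<close> is not tight, so it can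
            afford the loss of the single value \<open>x\<close>.\<close>
          have "L \<subset> I" using L a by blast
          then have "card L < card (\<Union> (N ` L))" using False strict by (meson not_le)
          moreover have "(\<Union>i\<in>L. N i - {x}) = \<Union> (N ` L) - {x}" by blast
          ultimately show ?thesis by (auto simp: card_Diff_singleton_if)
        qed simp
      qed
      then obtain h where h: "inj_on h (I - {a})" "\<And>i. i \<in> I - {a} \<Longrightarrow> h i \<in> N i - {x}" by blast
      have "inj_on (h(a := x)) I"
        using h unfolding inj_on_def by (auto simp: fun_upd_def)
      moreover have "\<forall>i\<in>I. (h(a := x)) i \<in> N i" using h(2) x by auto
      ultimately show ?thesis by blast
    qed
  qed
qed

section \<open>Baranyai's theorem\<close>

text \<open>
  Baranyai's theorem is proved by adding the points one at a time. With \<open>l\<close> points placed and \<open>n\<close>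
  still missing, a set of \<open>s\<close> placed points has \<open>occ n r s\<close> extensions to an \<open>r\<close>-set, so it has to occur
  that often as a block. A family of partitions is stored as \<open>f\<close>, where \<open>f i x\<close> is the index of the
  block of partition \<open>i\<close> containing \<open>x\<close>; this allows the empty block to be repeated.
\<close>

definition occ :: "nat \<Rightarrow> nat \<Rightarrow> nat \<Rightarrow> nat" where
  "occ n r s = (if s \<le> r then n choose (r - s) else 0)"

text \<open>The absorption identity for binomial coefficients. The left side will count the free
  places in all copies of a set, the right side \<open>Suc n\<close> times the number of copies that
  have to receive the next point.\<close>

lemma occ_absorb:
  "(r - s) * occ (Suc n) r s = Suc n * occ n r (Suc s)"
proof (cases "Suc s \<le> r")
  case True
  then obtain k where "r = Suc s + k" using le_Suc_ex by blast
  then have "r = s + Suc k" by simp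
  then show ?thesis using Suc_times_binomial_eq[of n k]
    by (simp add: occ_def mult.commute del: binomial_Suc_Suc)
qed (auto simp: occ_def)

text \<open>Pascal's rule: an extension of the placed set either avoids the next point or contains
  it.\<close>

lemma occ_pascal:
  "occ (Suc n) r s = occ n r s + occ n r (Suc s)"
proof (cases "Suc s \<le> r")
  case True
  then obtain k where "r = Suc s + k" using le_Suc_ex by blast
  then have "r = s + Suc k" by simp
  then show ?thesis by (simp add: occ_def)
qed (auto simp: occ_def)

definition block :: "nat \<Rightarrow> (nat \<Rightarrow> nat \<Rightarrow> nat) \<Rightarrow> nat \<times> nat \<Rightarrow> nat set" where
  "block l f = (\<lambda>(i, b). {x. x < l \<and> f i x = b})"

text \<open>The parameters: \<open>n\<close> points still missing, final block size
  \<open>r\<close>, \<open>M\<close> partitions into \<open>m\<close> possibly empty blocks,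
  \<open>l\<close> points placed. Occurrences are counted by index pairs, hence with
  multiplicity.\<close>

definition balanced :: "nat \<Rightarrow> nat \<Rightarrow> nat \<Rightarrow> nat \<Rightarrow> nat \<Rightarrow> (nat \<Rightarrow> nat \<Rightarrow> nat) \<Rightarrow> bool" where
  "balanced n r M m l f \<longleftrightarrow> (\<forall>i<M. \<forall>x<l. f i x < m) \<and>
    (\<forall>A. A \<subseteq> {..<l} \<longrightarrow> card {p \<in> {..<M} \<times> {..<m}. block l f p = A} = occ n r (card A))"

lemma sum_fibres:
  fixes w :: "'b \<Rightarrow> nat"
  assumes "finite X" "finite \<Y>"
  shows "(\<Sum>p\<in>{p \<in> X. q p \<in> \<Y>}. w (q p)) = (\<Sum>y\<in>\<Y>. card {p \<in> X. q p = y} * w y)"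
proof -
  have "(\<Sum>p\<in>{p \<in> X. q p \<in> \<Y>}. w (q p)) = (\<Sum>y\<in>\<Y>. \<Sum>p\<in>{p \<in> {p \<in> X. q p \<in> \<Y>}. q p = y}. w (q p))"
    using assms by (intro sum.group[symmetric]) auto
  also have "\<dots> = (\<Sum>y\<in>\<Y>. card {p \<in> X. q p = y} * w y)"
  proof (rule sum.cong[OF refl])
    fix y assume "y \<in> \<Y>"
    then have "{p \<in> {p \<in> X. q p \<in> \<Y>}. q p = y} = {p \<in> X. q p = y}" by auto
    then show "(\<Sum>p\<in>{p \<in> {p \<in> X. q p \<in> \<Y>}. q p = y}. w (q p)) = card {p \<in> X. q p = y} * w y" by simp
  qed
  finally show ?thesis .
qed

lemma sum_card_blocks:
  assumes "\<forall>x<l. f i x < m"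
  shows "(\<Sum>b<m. card (block l f (i, b))) = l"
proof -
  have "(\<Sum>b<m. card {x \<in> {..<l}. f i x = b}) = (\<Sum>b<m. \<Sum>x\<in>{x \<in> {..<l}. f i x = b}. 1)" by simp
  also have "\<dots> = (\<Sum>x<l. 1)" by (rule sum.group) (use assms in auto)
  finally show ?thesis by (simp add: block_def lessThan_def)
qed

text \<open>A block with more than \<open>r\<close> points would occur at least once, while
  \<open>occ\<close> prescribes no occurrence at all.\<close>

lemma balanced_block_card:
  assumes "balanced n r M m l f" "i < M" "b < m"
  shows "card (block l f (i, b)) \<le> r"
proof (rule ccontr)
  assume gt: "\<not> ?thesis"
  let ?A = "block l f (i, b)"
  have "?A \<subseteq> {..<l}" by (auto simp: block_def)
  then have "card {p \<in> {..<M} \<times> {..<m}. block l f p = ?A} = occ n r (card ?A)"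
    using assms(1) unfolding balanced_def by blast
  then have "card {p \<in> {..<M} \<times> {..<m}. block l f p = ?A} = 0" using gt by (simp add: occ_def)
  then have "{p \<in> {..<M} \<times> {..<m}. block l f p = ?A} = {}" by (subst (asm) card_0_eq) auto
  then show False using assms(2,3) by blast
qed

text \<open>The blocks of one partition have room for \<open>m * r\<close> points and contain
  \<open>l\<close>. By \<open>balanced_block_card\<close> no difference is truncated.\<close>

lemma balanced_weight:
  assumes "balanced n r M m l f" "i < M" "m * r = l + n"
  shows "(\<Sum>b<m. r - card (block l f (i, b))) = n"
proof -
  have "(\<Sum>b<m. r - card (block l f (i, b))) + (\<Sum>b<m. card (block l f (i, b)))
      = (\<Sum>b<m. r)"
    unfolding sum.distrib[symmetric] using balanced_block_card[OF assms(1,2)]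
    by (intro sum.cong) auto
  moreover have "(\<Sum>b<m. card (block l f (i, b))) = l"
    by (rule sum_card_blocks) (use assms in \<open>auto simp: balanced_def\<close>)
  ultimately show ?thesis using assms(3) by simp
qed

text \<open>Grouping the blocks by the set they equal reduces the count of free places to
  \<open>occ_absorb\<close>, one set at a time.\<close>

lemma balanced_weight_sets:
  assumes bal: "balanced (Suc n) r M m l f" and "\<Y> \<subseteq> Pow {..<l}"
  shows "(\<Sum>p\<in>{p \<in> {..<M} \<times> {..<m}. block l f p \<in> \<Y>}. r - card (block l f p))
    = Suc n * (\<Sum>A\<in>\<Y>. occ n r (Suc (card A)))"
proof -
  have fin: "finite \<Y>" using assms(2) by (rule finite_subset) simp
  have "(\<Sum>p\<in>{p \<in> {..<M} \<times> {..<m}. block l f p \<in> \<Y>}. r - card (block l f p))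
      = (\<Sum>A\<in>\<Y>. card {p \<in> {..<M} \<times> {..<m}. block l f p = A} * (r - card A))"
    by (rule sum_fibres) (use fin in auto)
  also have "\<dots> = (\<Sum>A\<in>\<Y>. Suc n * occ n r (Suc (card A)))"
  proof (rule sum.cong[OF refl])
    fix A assume "A \<in> \<Y>"
    then have "card {p \<in> {..<M} \<times> {..<m}. block l f p = A} = occ (Suc n) r (card A)"
      using bal assms(2) unfolding balanced_def by auto
    then show "card {p \<in> {..<M} \<times> {..<m}. block l f p = A} * (r - card A)
        = Suc n * occ n r (Suc (card A))"
      using occ_absorb[of r "card A" n] by (simp add: mult.commute)
  qed
  finally show ?thesis by (simp add: sum_distrib_left)
qed

text \<open>
  Hall's condition holds because adding the point \<open>l\<close> to each block with weight
  \<open>(r - |block|) / (n + 1)\<close> is a fractional solution.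
\<close>

lemma balanced_choice:
  assumes bal: "balanced (Suc n) r M m l f" and mr: "m * r = l + Suc n"
  obtains c where "\<And>i. i < M \<Longrightarrow> c i < m"
    "\<And>A. A \<subseteq> {..<l} \<Longrightarrow> card {i. i < M \<and> block l f (i, c i) = A} = occ n r (Suc (card A))"
proof -
  define w where "w A = occ n r (Suc (card A))" for A :: "nat set"
  \<comment> \<open>Each set \<open>A\<close> occurring as a block of partition \<open>i\<close> is
    offered in \<open>w A\<close> copies, so an injective choice uses \<open>A\<close> at most
    \<open>w A\<close> times.\<close>
  define N where "N i = (SIGMA A : (\<lambda>b. block l f (i, b)) ` {..<m}. {..<w A})" for i
  have sub: "block l f p \<subseteq> {..<l}" for p by (auto simp: block_def split: prod.splits)
  have weight: "Suc n * card J = (\<Sum>p\<in>J \<times> {..<m}. r - card (block l f p))" if "J \<subseteq> {..<M}" for J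
  proof -
    have "(\<Sum>p\<in>J \<times> {..<m}. r - card (block l f p)) = (\<Sum>i\<in>J. \<Sum>b<m. r - card (block l f (i, b)))"
      by (simp add: sum.cartesian_product)
    also have "\<dots> = (\<Sum>i\<in>J. Suc n)"
      using that by (intro sum.cong[OF refl] balanced_weight[OF bal _ mr]) auto
    finally show ?thesis by simp
  qed
  have "\<exists>h. inj_on h {..<M} \<and> (\<forall>i\<in>{..<M}. h i \<in> N i)"
  proof (rule hall_marriage)
    fix J assume J: "J \<subseteq> {..<M}"
    define \<Y> where "\<Y> = block l f ` (J \<times> {..<m})"
    have finJ: "finite J" using J by (rule finite_subset) simp
    have "\<Union> (N ` J) = (SIGMA A : \<Y>. {..<w A})"
      unfolding N_def \<Y>_def by auto
    then have card: "card (\<Union> (N ` J)) = (\<Sum>A\<in>\<Y>. w A)"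
      using finJ by (simp add: \<Y>_def)
    \<comment> \<open>Each partition has \<open>Suc n\<close> free places. Those of \<open>J\<close>
      are among the free places of all blocks whose set lies in \<open>\<Y>\<close>, and the latter
      number \<open>Suc n\<close> times the size of the neighbourhood.\<close>
    have "Suc n * card J = (\<Sum>p\<in>J \<times> {..<m}. r - card (block l f p))" by (rule weight[OF J])
    also have "\<dots> \<le> (\<Sum>p\<in>{p \<in> {..<M} \<times> {..<m}. block l f p \<in> \<Y>}. r - card (block l f p))"
      by (rule sum_mono2) (use J in \<open>auto simp: \<Y>_def\<close>)
    also have "\<dots> = Suc n * (\<Sum>A\<in>\<Y>. w A)"
      unfolding w_def by (rule balanced_weight_sets[OF bal]) (use sub in \<open>auto simp: \<Y>_def\<close>)
    finally show "card J \<le> card (\<Union> (N ` J))" unfolding card by (rule Suc_mult_le_cancel1[THEN iffD1])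
  qed (auto simp: N_def)
  then obtain h where h: "inj_on h {..<M}" "\<And>i. i < M \<Longrightarrow> h i \<in> N i" by auto
  have "\<forall>i<M. \<exists>b<m. block l f (i, b) = fst (h i)" using h(2) unfolding N_def by force
  then obtain c where c: "\<And>i. i < M \<Longrightarrow> c i < m \<and> block l f (i, c i) = fst (h i)" by metis
  let ?u = "\<lambda>A. card {i. i < M \<and> block l f (i, c i) = A}"
  have le: "?u A \<le> w A" for A
  proof -
    have "{i. i < M \<and> block l f (i, c i) = A} = {i. i < M \<and> fst (h i) = A}" using c by auto
    moreover have "card {i. i < M \<and> fst (h i) = A} \<le> card {..<w A}"
    proof (rule card_inj_on_le)
      show "inj_on (\<lambda>i. snd (h i)) {i. i < M \<and> fst (h i) = A}"
        using h(1) by (auto simp: inj_on_def prod_eq_iff)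
      show "(\<lambda>i. snd (h i)) ` {i. i < M \<and> fst (h i) = A} \<subseteq> {..<w A}"
        using h(2) unfolding N_def by force
    qed simp
    ultimately show ?thesis by simp
  qed
  \<comment> \<open>The matching only gives upper bounds. Both sides sum to \<open>M\<close> over
    all \<open>A\<close>, so every bound is attained.\<close>
  have "Suc n * M = (\<Sum>p\<in>{..<M} \<times> {..<m}. r - card (block l f p))" using weight[of "{..<M}"] by simp
  also have "\<dots> = (\<Sum>p\<in>{p \<in> {..<M} \<times> {..<m}. block l f p \<in> Pow {..<l}}. r - card (block l f p))"
    using sub by (intro sum.cong) auto
  also have "\<dots> = Suc n * (\<Sum>A\<in>Pow {..<l}. w A)"
    unfolding w_def by (rule balanced_weight_sets[OF bal]) simp
  finally have "(\<Sum>A\<in>Pow {..<l}. w A) = M" by (metis Suc_mult_cancel1)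
  also have "M = (\<Sum>i<M. 1)" by simp
  also have "\<dots> = (\<Sum>A\<in>Pow {..<l}. \<Sum>i\<in>{i \<in> {..<M}. block l f (i, c i) = A}. 1)"
    by (rule sum.group[symmetric]) (use sub in auto)
  also have "\<dots> = (\<Sum>A\<in>Pow {..<l}. ?u A)" by simp
  finally have eq: "(\<Sum>A\<in>Pow {..<l}. ?u A) = (\<Sum>A\<in>Pow {..<l}. w A)" ..
  have "?u A = w A" if "A \<subseteq> {..<l}" for A
    by (rule sum_mono_inv[OF eq le]) (use that in auto)
  then show thesis using c that unfolding w_def by blast
qed

text \<open>The point \<open>l\<close> joins block \<open>c i\<close> of partition \<open>i\<close>.
  Sets containing \<open>l\<close> are then counted by the choice itself; a set avoiding
  \<open>l\<close> loses the chosen copies, and \<open>occ_pascal\<close> gives the number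
  left.\<close>

lemma balanced_extend:
  assumes bal: "balanced (Suc n) r M m l f" and mr: "m * r = l + Suc n"
  shows "\<exists>f'. balanced n r M m (Suc l) f'"
proof -
  obtain c where c: "\<And>i. i < M \<Longrightarrow> c i < m"
    "\<And>A. A \<subseteq> {..<l} \<Longrightarrow> card {i. i < M \<and> block l f (i, c i) = A} = occ n r (Suc (card A))"
    using balanced_choice[OF assms] by blast
  define f' where "f' i = (f i)(l := c i)" for i
  have block': "block (Suc l) f' (i, b) = (if b = c i then insert l (block l f (i, b)) else block l f (i, b))" for i b
    by (auto simp: block_def f'_def less_Suc_eq)
  have nl: "l \<notin> block l f p" for p by (auto simp: block_def split: prod.splits)
  have "card {p \<in> {..<M} \<times> {..<m}. block (Suc l) f' p = A} = occ n r (card A)"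
    if A: "A \<subseteq> {..<Suc l}" for A
  proof (cases "l \<in> A")
    case True
    define A' where "A' = A - {l}"
    have A': "A = insert l A'" "l \<notin> A'" "A' \<subseteq> {..<l}" "finite A'"
      using True A finite_subset[OF A] unfolding A'_def by (auto simp: less_Suc_eq)
    have "block (Suc l) f' (i, b) = A \<longleftrightarrow> b = c i \<and> block l f (i, c i) = A'" for i b
      using nl[of "(i, b)"] A'(1,2) unfolding block' by auto
    then have "{p \<in> {..<M} \<times> {..<m}. block (Suc l) f' p = A}
        = (\<lambda>i. (i, c i)) ` {i. i < M \<and> block l f (i, c i) = A'}"
      using c(1) by auto
    then have "card {p \<in> {..<M} \<times> {..<m}. block (Suc l) f' p = A} = occ n r (Suc (card A'))"
      using c(2)[OF A'(3)] by (simp add: card_image inj_on_def)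
    then show ?thesis using A' by simp
  next
    case False
    then have Al: "A \<subseteq> {..<l}" using A by (auto simp: less_Suc_eq subset_eq)
    let ?T = "{p \<in> {..<M} \<times> {..<m}. block l f p = A}"
    let ?C = "(\<lambda>i. (i, c i)) ` {i. i < M \<and> block l f (i, c i) = A}"
    have "block (Suc l) f' (i, b) = A \<longleftrightarrow> b \<noteq> c i \<and> block l f (i, b) = A" for i b
      using False unfolding block' by auto
    then have "{p \<in> {..<M} \<times> {..<m}. block (Suc l) f' p = A} = ?T - ?C" by auto
    moreover have "card (?T - ?C) = card ?T - card ?C"
      using c(1) by (intro card_Diff_subset) auto
    moreover have "card ?C = occ n r (Suc (card A))"
      using c(2)[OF Al] by (simp add: card_image inj_on_def)
    moreover have "card ?T = occ (Suc n) r (card A)" using bal Al unfolding balanced_def by blast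
    ultimately show ?thesis by (simp add: occ_pascal)
  qed
  moreover have "\<forall>i<M. \<forall>x<Suc l. f' i x < m"
    using bal c(1) unfolding balanced_def f'_def by (auto simp: less_Suc_eq)
  ultimately show ?thesis unfolding balanced_def by blast
qed

text \<open>Initially all \<open>M * m\<close> blocks are empty, and
  \<open>M * m = K choose r\<close> is what \<open>occ\<close> prescribes for the empty set. Once
  all points are placed, \<open>occ 0 r\<close> is the indicator of size \<open>r\<close>, so each
  \<open>r\<close>-set is a block exactly once.\<close>

theorem baranyai:
  assumes "0 < r" "r dvd K" "0 < K"
  shows "\<exists>\<P>. (\<forall>i<(K - 1) choose (r - 1). partition_on {..<K} (\<P> i) \<and> (\<forall>A\<in>\<P> i. card A = r)) \<and>
    (\<forall>A. A \<subseteq> {..<K} \<and> card A = r \<longrightarrow> (\<exists>!i. i < (K - 1) choose (r - 1) \<and> A \<in> \<P> i))"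
proof -
  define M m where "M = (K - 1) choose (r - 1)" and "m = K div r"
  have mr: "m * r = K" using assms by (simp add: m_def)
  have "\<exists>f. balanced (K - l) r M m l f" if "l \<le> K" for l
    using that
  proof (induction l)
    case 0
    have "M * m = K choose r"
    proof -
      have "K * (K - 1 choose (r - 1)) = (K choose r) * r"
        using assms(1,3) Suc_times_binomial_eq[of "K - 1" "r - 1"] by simp
      then have "K * M = r * (K choose r)" unfolding M_def by (simp only: mult.commute)
      moreover have "r * (M * m) = K * M" unfolding mr[symmetric] by (simp only: ac_simps)
      ultimately have "r * (M * m) = r * (K choose r)" by simp
      then show ?thesis using assms(1) by simp
    qed
    then show ?case
      by (auto simp: balanced_def block_def occ_def card_cartesian_product
        case_prod_unfold mem_Times_iff[symmetric] intro!: exI[of _ "\<lambda>_ _. 0"])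
  next
    case (Suc l)
    then obtain f where f: "balanced (K - l) r M m l f" by auto
    have "K - l = Suc (K - Suc l)" using Suc.prems by simp
    then show ?case using balanced_extend[of "K - Suc l" r M m l f] f mr Suc.prems by simp
  qed
  then obtain f where "balanced 0 r M m K f" by fastforce
  moreover have "occ 0 r s = (if s = r then 1 else 0)" for s by (simp add: occ_def)
  ultimately have range: "\<And>i x. i < M \<Longrightarrow> x < K \<Longrightarrow> f i x < m"
    and count: "\<And>A. A \<subseteq> {..<K} \<Longrightarrow>
      card {p \<in> {..<M} \<times> {..<m}. block K f p = A} = (if card A = r then 1 else 0)"
    unfolding balanced_def by auto
  define \<P> where "\<P> i = (\<lambda>b. block K f (i, b)) ` {..<m}" for i
  have card_block: "card (block K f (i, b)) = r" if "i < M" "b < m" for i b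
  proof (rule ccontr)
    assume "card (block K f (i, b)) \<noteq> r"
    moreover have "block K f (i, b) \<subseteq> {..<K}" by (auto simp: block_def)
    ultimately have "{p \<in> {..<M} \<times> {..<m}. block K f p = block K f (i, b)} = {}"
      using count[of "block K f (i, b)"] by (subst card_0_eq[symmetric]) auto
    then show False using that by blast
  qed
  have "partition_on {..<K} (\<P> i)" if "i < M" for i
  proof (rule partition_onI)
    show "\<Union> (\<P> i) = {..<K}" using range[OF that] by (auto simp: \<P>_def block_def)
    show "disjnt A B" if "A \<in> \<P> i" "B \<in> \<P> i" "A \<noteq> B" for A B
      using that by (auto simp: \<P>_def block_def disjnt_def)
    show "{} \<notin> \<P> i"
      using card_block[OF that] assms(1) by (fastforce simp: \<P>_def)
  qed
  moreover have "\<exists>!i. i < M \<and> A \<in> \<P> i" if A: "A \<subseteq> {..<K}" "card A = r" for A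
  proof -
    obtain q where "{p \<in> {..<M} \<times> {..<m}. block K f p = A} = {q}"
      using count[OF A(1)] A(2) by (auto simp: card_1_singleton_iff)
    then have q: "p \<in> {..<M} \<times> {..<m} \<and> block K f p = A \<longleftrightarrow> p = q" for p by blast
    show ?thesis
    proof (rule ex1I[of _ "fst q"])
      show "fst q < M \<and> A \<in> \<P> (fst q)" using q[of q] by (cases q) (auto simp: \<P>_def)
      show "i = fst q" if "i < M \<and> A \<in> \<P> i" for i
        using that q by (force simp: \<P>_def)
    qed
  qed
  ultimately show ?thesis using card_block unfolding M_def[symmetric]
    by (intro exI[of _ \<P>]) (auto simp: \<P>_def)
qed

section \<open>A lower bound on the number of symbols\<close>

lemma columns_of_iff: "k \<in> columns_of K F P s \<longleftrightarrow> k < K \<and> (\<exists>j<F. P j k = Some s)"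
  by (simp add: columns_of_def)

lemma finite_columns_of [simp]: "finite (columns_of K F P s)"
  by (simp add: columns_of_def)

text \<open>Replaces the enumerations in the definition by the full row \<open>j0\<close> and the
  map \<open>\<delta>\<close> from a column of \<open>s\<close> to its diagonal row.\<close>

lemma spda_symbolE:
  assumes "spda K F Z S P" "s < S"
  obtains j0 \<delta> where
    "j0 < F"
    "\<And>k. k \<in> columns_of K F P s \<Longrightarrow> P j0 k = Some s"
    "\<And>k. k \<in> columns_of K F P s \<Longrightarrow> \<delta> k < F \<and> \<delta> k \<noteq> j0 \<and> P (\<delta> k) k = Some s"
    "\<And>k k'. k \<in> columns_of K F P s \<Longrightarrow> k' \<in> columns_of K F P s \<Longrightarrow> k \<noteq> k' \<Longrightarrow> P (\<delta> k) k' = None"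
    "\<And>j k. j < F \<Longrightarrow> k < K \<Longrightarrow> P j k = Some s \<Longrightarrow> j = j0 \<or> j = \<delta> k"
    "2 \<le> card (columns_of K F P s)"
proof -
  let ?U = "columns_of K F P s"
  have "\<forall>s<S. \<exists>(g::nat) r c.
      bij_betw r {..<g + 1} (rows_of K F P s) \<and> bij_betw c {..<g} (columns_of K F P s) \<and>
      (\<forall>i<g. P (r 0) (c i) = Some s) \<and>
      (\<forall>i<g. \<forall>i'<g. P (r (i + 1)) (c i') = (if i = i' then Some s else None))"
    using assms(1) unfolding spda_def by (elim conjE)
  from this[rule_format, OF assms(2)] obtain g :: nat and r c
    where r: "bij_betw r {..<g + 1} (rows_of K F P s)"
    and c: "bij_betw c {..<g} ?U"
    and top: "\<forall>i<g. P (r 0) (c i) = Some s"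
    and diag: "\<forall>i<g. \<forall>i'<g. P (r (i + 1)) (c i') = (if i = i' then Some s else None)"
    by (elim exE conjE)
  have rF: "r i < F" if "i \<le> g" for i
    using bij_betwE[OF r] that by (auto simp: rows_of_def)
  have rinj: "r i = r i' \<longleftrightarrow> i = i'" if "i \<le> g" "i' \<le> g" for i i'
    using bij_betw_imp_inj_on[OF r] that by (auto simp: inj_on_def)
  define \<iota> where "\<iota> = the_inv_into {..<g} c"
  have \<iota>: "\<iota> k < g" "c (\<iota> k) = k" if "k \<in> ?U" for k
    using that c the_inv_into_into[of c "{..<g}" k] f_the_inv_into_f[of c "{..<g}" k]
    unfolding \<iota>_def bij_betw_def by auto
  define \<delta> where "\<delta> k = r (\<iota> k + 1)" for k
  show thesis
  proof (rule that[of "r 0" \<delta>])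
    show "r 0 < F" by (rule rF) simp
    show top': "P (r 0) k = Some s" if "k \<in> ?U" for k using top \<iota>[OF that] by metis
    show \<delta>: "\<delta> k < F \<and> \<delta> k \<noteq> r 0 \<and> P (\<delta> k) k = Some s" if "k \<in> ?U" for k
    proof (intro conjI)
      show "\<delta> k < F" unfolding \<delta>_def by (rule rF) (use \<iota>[OF that] in simp)
      show "\<delta> k \<noteq> r 0" unfolding \<delta>_def using rinj[of "\<iota> k + 1" 0] \<iota>(1)[OF that] by simp
      show "P (\<delta> k) k = Some s" unfolding \<delta>_def using diag \<iota>[OF that] by metis
    qed
    show "P (\<delta> k) k' = None" if "k \<in> ?U" "k' \<in> ?U" "k \<noteq> k'" for k k'
      unfolding \<delta>_def using diag \<iota>[OF that(1)] \<iota>[OF that(2)] that(3) by metis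
    show rows: "j = r 0 \<or> j = \<delta> k" if "j < F" "k < K" "P j k = Some s" for j k
    proof -
      have k: "k \<in> ?U" using that by (auto simp: columns_of_iff)
      have "j \<in> r ` {..<g + 1}" using that bij_betw_imp_surj_on[OF r] by (auto simp: rows_of_def)
      then obtain i where i: "j = r i" "i \<le> g" by auto
      show ?thesis
      proof (cases i)
        case (Suc i')
        then have "P (r (i' + 1)) (c (\<iota> k)) = Some s" using that i \<iota>[OF k] by simp
        then have "i' = \<iota> k" using diag i Suc \<iota>[OF k]
          by (metis Suc_le_lessD option.distinct(1))
        then show ?thesis using i Suc by (simp add: \<delta>_def)
      qed (use i in simp)
    qed
    \<comment> \<open>The symbol fills at most two cells per column, so four occurrences force two
      columns. This is what makes the repeated row unique later.\<close>
    let ?C = "{(j, k). j < F \<and> k < K \<and> P j k = Some s}"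
    have "?C \<subseteq> Pair (r 0) ` ?U \<union> (\<lambda>k. (\<delta> k, k)) ` ?U"
      using rows by (fastforce simp: columns_of_iff)
    then have "card ?C \<le> card (Pair (r 0) ` ?U \<union> (\<lambda>k. (\<delta> k, k)) ` ?U)"
      by (rule card_mono[rotated]) simp
    also have "\<dots> \<le> card ?U + card ?U"
      by (rule order_trans[OF card_Un_le add_mono]) (simp_all add: card_image_le)
    finally show "2 \<le> card ?U" using assms unfolding spda_def by auto
  qed
qed

text \<open>
  With \<open>z\<close> stars and \<open>a\<close> cells below the repeated rows, a row accounts for at least \<open>a / (z + 1)\<close>
  symbols. The linear minorant \<open>\<lambda> a - \<mu> z\<close> below (with denominators cleared) has its two Lagrange
  multipliers chosen so that it is tight both at \<open>(a, z) = (K - t, t)\<close> and at \<open>(a, z) = (0, 0)\<close>,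
  the two kinds of rows of the optimal array.
\<close>

lemma cell_weight_bound:
  fixes a z K t :: real
  assumes "0 \<le> a" "0 \<le> z" "0 < K" "a + z \<le> K"
  shows "(z + 1) * ((K * (2 * t + 1) - t\<^sup>2) * a - (K - t)\<^sup>2 * z) \<le> K * (t + 1)\<^sup>2 * a"
proof (cases "z = K")
  case True
  then show ?thesis using assms by (simp add: mult_nonneg_nonpos)
next
  case False
  define E where "E = K * (t + 1)\<^sup>2 * a - (z + 1) * ((K * (2 * t + 1) - t\<^sup>2) * a - (K - t)\<^sup>2 * z)"
  \<comment> \<open>Multiplied by \<open>K - z\<close>, which is positive here, the gap is a sum of
    two nonnegative terms. One vanishes at \<open>z = t\<close>, the other when the row has no cells
    besides its stars and the \<open>a\<close> counted ones.\<close>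
  have "(K - z) * E = a * (K * (K + 1) * (z - t)\<^sup>2) + (K - z - a) * ((z + 1) * ((K - t)\<^sup>2 * z))"
    unfolding E_def by (simp add: algebra_simps power2_eq_square)
  also have "\<dots> \<ge> 0"
    using assms by (intro add_nonneg_nonneg mult_nonneg_nonneg) auto
  finally have "0 \<le> E" using False assms by (simp add: zero_le_mult_iff)
  then show ?thesis unfolding E_def by simp
qed

text \<open>A symbol takes two cells in each of its columns, one in the repeated row and one on the
  diagonal; with the \<open>K * Z\<close> stars these exhaust the array.\<close>

lemma spda_card_pairs:
  assumes "spda K F Z S P"
  shows "2 * (\<Sum>s<S. card (columns_of K F P s)) + K * Z = K * F"
proof -
  let ?U = "columns_of K F P"
  let ?C = "\<lambda>s. {(j, k). j < F \<and> k < K \<and> P j k = Some s}"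
  let ?N = "{(j, k). j < F \<and> k < K \<and> P j k = None}"
  have fin: "finite {(j, k). j < F \<and> k < K \<and> Q j k}" for Q
    by (rule finite_subset[of _ "{..<F} \<times> {..<K}"]) auto
  have "card (?C s) = 2 * card (?U s)" if s: "s < S" for s
  proof -
    obtain j0 \<delta> where d: "j0 < F" "\<And>k. k \<in> ?U s \<Longrightarrow> P j0 k = Some s"
      "\<And>k. k \<in> ?U s \<Longrightarrow> \<delta> k < F \<and> \<delta> k \<noteq> j0 \<and> P (\<delta> k) k = Some s"
      "\<And>j k. j < F \<Longrightarrow> k < K \<Longrightarrow> P j k = Some s \<Longrightarrow> j = j0 \<or> j = \<delta> k"
      by (rule spda_symbolE[OF assms s]) (rule that)
    have "?C s = Pair j0 ` ?U s \<union> (\<lambda>k. (\<delta> k, k)) ` ?U s"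
    proof (intro equalityI subsetI)
      fix p assume "p \<in> ?C s"
      then obtain j k where p: "p = (j, k)" "j < F" "k < K" "P j k = Some s" by blast
      then have "k \<in> ?U s" by (auto simp: columns_of_iff)
      then show "p \<in> Pair j0 ` ?U s \<union> (\<lambda>k. (\<delta> k, k)) ` ?U s" using d(4)[OF p(2-4)] p(1) by blast
    qed (use d in \<open>auto simp: columns_of_iff\<close>)
    also have "card \<dots> = card (?U s) + card (?U s)"
      using d(3) by (subst card_Un_disjoint) (auto simp: card_image inj_on_def)
    finally show ?thesis by simp
  qed
  then have "2 * (\<Sum>s<S. card (?U s)) = (\<Sum>s<S. card (?C s))" by (simp add: sum_distrib_left)
  also have "\<dots> = card (\<Union>s<S. ?C s)"
    using fin by (intro card_UN_disjoint[symmetric]) auto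
  finally have 1: "2 * (\<Sum>s<S. card (?U s)) = card (\<Union>s<S. ?C s)" .
  have "?N = (\<lambda>(k, j). (j, k)) ` (SIGMA k : {..<K}. {j. j < F \<and> P j k = None})" by auto
  then have "card ?N = card (SIGMA k : {..<K}. {j. j < F \<and> P j k = None})"
    by (simp add: card_image inj_on_def split_beta prod_eq_iff)
  also have "\<dots> = K * Z" using assms by (simp add: spda_def)
  finally have 2: "card ?N = K * Z" .
  have "{..<F} \<times> {..<K} = (\<Union>s<S. ?C s) \<union> ?N"
  proof -
    have "P j k = None \<or> (\<exists>s<S. P j k = Some s)" if "j < F" "k < K" for j k
      using that assms unfolding spda_def by (cases "P j k") auto
    then show ?thesis by auto
  qed
  then have "card ({..<F} \<times> {..<K}) = card ((\<Union>s<S. ?C s) \<union> ?N)" by simp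
  also have "\<dots> = card (\<Union>s<S. ?C s) + card ?N"
    using fin by (intro card_Un_disjoint) auto
  finally show ?thesis using 1 2 by (simp add: mult.commute)
qed

text \<open>Summed over the rows, \<open>cell_weight_bound\<close> involves only the total weight,
  which is \<open>S\<close>, and the totals of \<open>a\<close> and \<open>z\<close>, which are
  fixed by \<open>K\<close>, \<open>F\<close> and \<open>Z\<close>. The real parameter
  \<open>t\<close> is free and can be tuned to the array.\<close>

lemma spda_symbols_bound:
  fixes t :: real
  assumes spda: "spda K F Z S P"
  shows "(K * (2 * t + 1) - t\<^sup>2) * (real F - real Z) / 2 - (K - t)\<^sup>2 * Z \<le> (t + 1)\<^sup>2 * S"
proof -
  let ?U = "columns_of K F P"
  have K: "0 < K" using spda by (simp add: spda_def)
  \<comment> \<open>Bundled into one predicate so that diagonal maps can be chosen for all symbols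
    at once.\<close>
  define Q where "Q s \<delta> \<longleftrightarrow> (\<forall>k\<in>?U s. \<delta> k < F \<and> P (\<delta> k) k = Some s \<and> (\<forall>k'\<in>?U s. k \<noteq> k' \<longrightarrow> P (\<delta> k) k' = None))" for s \<delta>
  have "\<exists>\<delta>. Q s \<delta>" if "s < S" for s
  proof -
    obtain j0 \<delta> where "\<And>k. k \<in> ?U s \<Longrightarrow> \<delta> k < F \<and> \<delta> k \<noteq> j0 \<and> P (\<delta> k) k = Some s"
      "\<And>k k'. k \<in> ?U s \<Longrightarrow> k' \<in> ?U s \<Longrightarrow> k \<noteq> k' \<Longrightarrow> P (\<delta> k) k' = None"
      by (rule spda_symbolE[OF spda \<open>s < S\<close>]) (rule that)
    then have "Q s \<delta>" by (simp add: Q_def)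
    then show "\<exists>\<delta>. Q s \<delta>" by blast
  qed
  then obtain \<delta> where \<delta>: "\<And>s. s < S \<Longrightarrow> Q s (\<delta> s)" by metis
  have Une: "0 < card (?U s)" if "s < S" for s
  proof -
    have "2 \<le> card (?U s)" by (rule spda_symbolE[OF spda that])
    then show "0 < card (?U s)" by linarith
  qed
  \<comment> \<open>A pair \<open>(s, k)\<close> in \<open>D\<close> stands for the diagonal cell of
    \<open>s\<close> in column \<open>k\<close>, which lies in row \<open>\<delta> s k\<close>; thus
    \<open>a j\<close> counts the diagonal cells in row \<open>j\<close>.\<close>
  define D where "D = (SIGMA s : {..<S}. ?U s)"
  define z a where "z j = card {k. k < K \<and> P j k = None}"
    and "a j = card {p \<in> D. \<delta> (fst p) (snd p) = j}" for j
  have finD: "finite D" by (simp add: D_def)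
  \<comment> \<open>Diagonal cells of one row lie in different columns, because the entry determines
    the symbol, and none of them is a star.\<close>
  have az: "a j + z j \<le> K" for j
  proof -
    have "a j = card (snd ` {p \<in> D. \<delta> (fst p) (snd p) = j})"
      unfolding a_def
    proof (rule card_image[symmetric], rule inj_onI)
      fix p q assume pq: "p \<in> {p \<in> D. \<delta> (fst p) (snd p) = j}" "q \<in> {p \<in> D. \<delta> (fst p) (snd p) = j}"
        "snd p = snd q"
      have "P j (snd p) = Some (fst p)" if "p \<in> {p \<in> D. \<delta> (fst p) (snd p) = j}" for p
        using that \<delta>[of "fst p"] by (auto simp: D_def Q_def)
      from this[OF pq(1)] this[OF pq(2)] show "p = q" using pq(3) by (simp add: prod_eq_iff)
    qed
    also have "\<dots> \<le> card {k. k < K \<and> P j k \<noteq> None}"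
      using \<delta> by (intro card_mono) (auto simp: D_def Q_def columns_of_iff)
    finally have "a j + z j \<le> card {k. k < K \<and> P j k \<noteq> None} + card {k. k < K \<and> P j k = None}"
      unfolding z_def by simp
    also have "\<dots> = card ({k. k < K \<and> P j k \<noteq> None} \<union> {k. k < K \<and> P j k = None})"
      by (rule card_Un_disjoint[symmetric]) auto
    also have "\<dots> = card {..<K}" by (rule arg_cong[of _ _ card]) auto
    finally show ?thesis by simp
  qed
  \<comment> \<open>In the diagonal row of column \<open>k\<close> all other columns of
    \<open>s\<close> hold stars.\<close>
  have Uz: "card (?U s) \<le> z (\<delta> s k) + 1" if "s < S" "k \<in> ?U s" for s k
  proof -
    have "card (?U s) = card (?U s - {k}) + 1" using that(2) card_Suc_Diff1[of "?U s" k] by simp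
    moreover have "card (?U s - {k}) \<le> z (\<delta> s k)"
      unfolding z_def using \<delta>[OF that(1)] that(2)
      by (intro card_mono) (auto simp: Q_def dest: columns_of_iff[THEN iffD1])
    ultimately show ?thesis by simp
  qed
  have Dgroup: "(\<Sum>j<F. \<Sum>p\<in>{p \<in> D. \<delta> (fst p) (snd p) = j}. h p) = sum h D" for h :: "_ \<Rightarrow> real"
    by (rule sum.group[OF finD]) (use \<delta> in \<open>auto simp: D_def Q_def\<close>)
  have row: "(K * (2 * t + 1) - t\<^sup>2) * a j - (K - t)\<^sup>2 * z j
      \<le> K * (t + 1)\<^sup>2 * (\<Sum>p\<in>{p \<in> D. \<delta> (fst p) (snd p) = j}. 1 / card (?U (fst p)))" for j
  proof -
    have "(K * (2 * t + 1) - t\<^sup>2) * a j - (K - t)\<^sup>2 * z j \<le> K * (t + 1)\<^sup>2 * (real (a j) / (real (z j) + 1))"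
    proof -
      have "real (a j) + real (z j) \<le> real K" using az[of j] by linarith
      then show ?thesis using cell_weight_bound[of "real (a j)" "real (z j)" "real K" t] K
        by (simp add: pos_le_divide_eq mult.commute add.commute)
    qed
    also have "\<dots> \<le> K * (t + 1)\<^sup>2 * (\<Sum>p\<in>{p \<in> D. \<delta> (fst p) (snd p) = j}. 1 / card (?U (fst p)))"
    proof (rule mult_left_mono)
      have "real (a j) / (real (z j) + 1) = (\<Sum>p\<in>{p \<in> D. \<delta> (fst p) (snd p) = j}. 1 / (real (z j) + 1))"
        by (simp add: a_def)
      also have "\<dots> \<le> (\<Sum>p\<in>{p \<in> D. \<delta> (fst p) (snd p) = j}. 1 / card (?U (fst p)))"
      proof (rule sum_mono)
        fix p assume p: "p \<in> {p \<in> D. \<delta> (fst p) (snd p) = j}"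
        then have "card (?U (fst p)) \<le> z j + 1" "0 < card (?U (fst p))"
          using Uz[of "fst p" "snd p"] Une by (auto simp: D_def)
        then show "1 / (real (z j) + 1) \<le> 1 / real (card (?U (fst p)))"
          by (intro divide_left_mono) auto
      qed
      finally show "real (a j) / (real (z j) + 1) \<le> (\<Sum>p\<in>{p \<in> D. \<delta> (fst p) (snd p) = j}. 1 / card (?U (fst p)))" .
    qed simp
    finally show ?thesis .
  qed
  \<comment> \<open>The diagonal cells of one symbol have total weight one, so the total weight
    counts the symbols.\<close>
  have "(\<Sum>p\<in>D. 1 / card (?U (fst p))) = (\<Sum>s<S. \<Sum>k\<in>?U s. 1 / card (?U s))"
    unfolding D_def by (subst sum.Sigma) (auto simp: split_beta)
  also have "\<dots> = (\<Sum>s<S. 1)" by (intro sum.cong) (use Une in fastforce)+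
  finally have S: "(\<Sum>p\<in>D. 1 / card (?U (fst p))) = S" by simp
  have "(\<Sum>j<F. real (a j)) = card D" using Dgroup[of "\<lambda>_. 1"] by (simp add: a_def)
  moreover have "card D = (\<Sum>s<S. card (?U s))" by (simp add: D_def)
  ultimately have sa: "(\<Sum>j<F. real (a j)) = K * (real F - real Z) / 2"
    using arg_cong[OF spda_card_pairs[OF spda], of real] by (simp add: algebra_simps)
  have "(\<Sum>j<F. z j) = card (SIGMA j : {..<F}. {k. k < K \<and> P j k = None})" by (simp add: z_def)
  also have "\<dots> = card (prod.swap ` (SIGMA j : {..<F}. {k. k < K \<and> P j k = None}))"
    by (simp add: card_image)
  also have "prod.swap ` (SIGMA j : {..<F}. {k. k < K \<and> P j k = None})
      = (SIGMA k : {..<K}. {j. j < F \<and> P j k = None})" by auto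
  also have "card \<dots> = K * Z" using spda by (simp add: spda_def)
  finally have "(\<Sum>j<F. real (z j)) = real (K * Z)" by (metis of_nat_sum)
  then have sz: "(\<Sum>j<F. real (z j)) = K * Z" by simp
  have "K * ((K * (2 * t + 1) - t\<^sup>2) * (real F - real Z) / 2 - (K - t)\<^sup>2 * Z)
      = (\<Sum>j<F. (K * (2 * t + 1) - t\<^sup>2) * a j - (K - t)\<^sup>2 * z j)"
    unfolding sum_subtractf sum_distrib_left[symmetric] sa sz by (simp add: field_simps)
  also have "\<dots> \<le> (\<Sum>j<F. K * (t + 1)\<^sup>2 * (\<Sum>p\<in>{p \<in> D. \<delta> (fst p) (snd p) = j}. 1 / card (?U (fst p))))"
    by (rule sum_mono) (rule row)
  also have "\<dots> = K * ((t + 1)\<^sup>2 * S)"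
    unfolding sum_distrib_left[symmetric] Dgroup S by simp
  finally show ?thesis using K by simp
qed

section \<open>Optimal arrays from Baranyai factorisations\<close>

lemma card_subsets_containing:
  fixes a :: 'a
  assumes "finite A" "a \<in> A" "0 < k"
  shows "card {B. B \<subseteq> A \<and> card B = k \<and> a \<in> B} = (card A - 1) choose (k - 1)"
proof -
  have "{B. B \<subseteq> A \<and> card B = k \<and> a \<in> B} = insert a ` {B. B \<subseteq> A - {a} \<and> card B = k - 1}"
  proof (intro equalityI subsetI)
    fix B assume B: "B \<in> {B. B \<subseteq> A \<and> card B = k \<and> a \<in> B}"
    then have "finite B" using assms(1) finite_subset by blast
    then have "B = insert a (B - {a})" "B - {a} \<in> {B. B \<subseteq> A - {a} \<and> card B = k - 1}"
      using B by auto
    then show "B \<in> insert a ` {B. B \<subseteq> A - {a} \<and> card B = k - 1}" by (rule image_eqI)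
  next
    fix B assume "B \<in> insert a ` {B. B \<subseteq> A - {a} \<and> card B = k - 1}"
    then obtain C where C: "B = insert a C" "C \<subseteq> A - {a}" "card C = k - 1" by blast
    then have "finite C" "a \<notin> C" using assms(1) finite_subset[OF C(2)] by auto
    then show "B \<in> {B. B \<subseteq> A \<and> card B = k \<and> a \<in> B}" using C assms(2,3) by auto
  qed
  also have "card \<dots> = card {B. B \<subseteq> A - {a} \<and> card B = k - 1}"
    by (rule card_image) (auto simp: inj_on_def)
  also have "\<dots> = (card A - 1) choose (k - 1)" using assms by (simp add: n_subsets)
  finally show ?thesis .
qed

text \<open>For a \<open>(t + 1)\<close>-set \<open>A\<close> the cells \<open>(A - {k}, k)\<close>
  with \<open>k \<in> A\<close> form a diagonal: in row \<open>A - {k}\<close> the other columns of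
  \<open>A\<close> hold stars. The full row comes from the unique partition having \<open>A\<close>
  as a block.\<close>

theorem ex_spda:
  assumes t: "0 < t" "t < K" and dvd: "(t + 1) dvd K"
  shows "\<exists>P. spda K ((K choose t) + ((K - 1) choose t)) ((K - 1) choose (t - 1)) (K choose (t + 1)) P"
proof -
  define n M where "n = K choose t" and "M = (K - 1) choose t"
  define \<T> where "\<T> = {A. A \<subseteq> {..<K} \<and> card A = t}"
  define \<S> where "\<S> = {A. A \<subseteq> {..<K} \<and> card A = t + 1}"
  have fin: "finite \<T>" "finite \<S>"
    unfolding \<T>_def \<S>_def by (rule finite_subset[of _ "Pow {..<K}"]; auto)+
  have "card \<T> = n" "card \<S> = K choose (t + 1)"
    using n_subsets[of "{..<K}" t] n_subsets[of "{..<K}" "t + 1"]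
    unfolding \<T>_def \<S>_def n_def by simp_all
  then obtain \<rho> idx where \<rho>: "bij_betw \<rho> \<T> {..<n}" and idx: "bij_betw idx \<S> {..<K choose (t + 1)}"
    using ex_bij_betw_finite_nat[OF fin(1)] ex_bij_betw_finite_nat[OF fin(2)]
    by (auto simp: atLeast0LessThan)
  define e where "e = the_inv_into \<T> \<rho>"
  have e: "e j \<in> \<T>" "\<rho> (e j) = j" if "j < n" for j
    using that \<rho> the_inv_into_into[of \<rho> \<T> j \<T>] f_the_inv_into_f[of \<rho> \<T> j]
    unfolding e_def bij_betw_def by auto
  have \<rho>n: "\<rho> B < n" "e (\<rho> B) = B" if "B \<in> \<T>" for B
    using that bij_betwE[OF \<rho>] the_inv_into_f_f[OF bij_betw_imp_inj_on[OF \<rho>]] by (auto simp: e_def)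
  obtain \<P> where part: "\<And>i. i < M \<Longrightarrow> partition_on {..<K} (\<P> i)"
    and size: "\<And>i A. i < M \<Longrightarrow> A \<in> \<P> i \<Longrightarrow> card A = t + 1"
    and cover: "\<And>A. A \<in> \<S> \<Longrightarrow> \<exists>!i. i < M \<and> A \<in> \<P> i"
    using baranyai[of "t + 1" K] dvd t unfolding M_def \<S>_def by auto
  have "\<exists>A. A \<in> \<P> i \<and> k \<in> A" if "i < M" "k < K" for i k
    using partition_onD1[OF part[OF that(1)]] that(2) by blast
  then obtain blk where blk: "\<And>i k. i < M \<Longrightarrow> k < K \<Longrightarrow> blk i k \<in> \<P> i \<and> k \<in> blk i k" by metis
  have blk_eq: "blk i k = A \<longleftrightarrow> k \<in> A" if "i < M" "k < K" "A \<in> \<P> i" for i k A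
    using blk[OF that(1,2)] that(3) partition_onD2[OF part[OF that(1)]] unfolding disjoint_def by blast
  have blkS: "blk i k \<in> \<S>" if "i < M" "k < K" for i k
    using blk[OF that] size[OF that(1)] partition_onD1[OF part[OF that(1)]] unfolding \<S>_def by blast
  \<comment> \<open>Row \<open>j < n\<close> belongs to the \<open>t\<close>-set \<open>e j\<close>
    and row \<open>n + i\<close> to the partition \<open>\<P> i\<close>; \<open>idx\<close> numbers
    the \<open>(t + 1)\<close>-sets.\<close>
  define P where "P j k = (if j < n then if k \<in> e j then None else Some (idx (insert k (e j)))
    else Some (idx (blk (j - n) k)))" for j k
  have insertS: "insert k (e j) \<in> \<S>" if "j < n" "k < K" "k \<notin> e j" for j k
  proof -
    have "e j \<subseteq> {..<K}" "card (e j) = t" using e(1)[OF that(1)] by (auto simp: \<T>_def)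
    moreover from this have "finite (e j)" using finite_subset by blast
    ultimately show ?thesis using that by (simp add: \<S>_def)
  qed
  have idx_eq: "idx A = idx B \<longleftrightarrow> A = B" if "A \<in> \<S>" "B \<in> \<S>" for A B
    using bij_betw_imp_inj_on[OF idx] that by (auto simp: inj_on_def)
  have range: "s < K choose (t + 1)" if "j < n + M" "k < K" "P j k = Some s" for j k s
  proof -
    have "\<exists>A\<in>\<S>. s = idx A"
      using that insertS[of j k] blkS[of "j - n" k] by (auto simp: P_def split: if_splits)
    then show ?thesis using bij_betwE[OF idx] by blast
  qed
  have stars: "card {j. j < n + M \<and> P j k = None} = (K - 1) choose (t - 1)" if k: "k < K" for k
  proof -
    have "{j. j < n + M \<and> P j k = None} = \<rho> ` {B. B \<subseteq> {..<K} \<and> card B = t \<and> k \<in> B}"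
    proof (intro equalityI subsetI)
      fix j assume "j \<in> {j. j < n + M \<and> P j k = None}"
      then have "j < n" "k \<in> e j" by (auto simp: P_def split: if_splits)
      then show "j \<in> \<rho> ` {B. B \<subseteq> {..<K} \<and> card B = t \<and> k \<in> B}"
        using e[of j] by (intro image_eqI[of _ _ "e j"]) (auto simp: \<T>_def)
    next
      fix j assume "j \<in> \<rho> ` {B. B \<subseteq> {..<K} \<and> card B = t \<and> k \<in> B}"
      then obtain B where "j = \<rho> B" "B \<in> \<T>" "k \<in> B" by (auto simp: \<T>_def)
      then show "j \<in> {j. j < n + M \<and> P j k = None}" using \<rho>n[of B] by (auto simp: P_def)
    qed
    moreover have "inj_on \<rho> {B. B \<subseteq> {..<K} \<and> card B = t \<and> k \<in> B}"
      by (rule inj_on_subset[OF bij_betw_imp_inj_on[OF \<rho>]]) (auto simp: \<T>_def)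
    ultimately show ?thesis using card_subsets_containing[of "{..<K}" k t] k t by (simp add: card_image)
  qed
  have shape: "4 \<le> card {(j, k). j < n + M \<and> k < K \<and> P j k = Some s} \<and>
    (\<exists>(g::nat) r c. bij_betw r {..<g + 1} (rows_of K (n + M) P s) \<and>
        bij_betw c {..<g} (columns_of K (n + M) P s) \<and> (\<forall>i<g. P (r 0) (c i) = Some s) \<and>
        (\<forall>i<g. \<forall>i'<g. P (r (i + 1)) (c i') = (if i = i' then Some s else None)))"
    if s: "s < K choose (t + 1)" for s
  proof -
    obtain A where A: "A \<in> \<S>" "s = idx A" using s bij_betw_imp_surj_on[OF idx] by blast
    have AK: "A \<subseteq> {..<K}" "card A = t + 1" "finite A"
      using A(1) finite_subset[of A "{..<K}"] by (auto simp: \<S>_def)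
    obtain q where q: "q < M" "A \<in> \<P> q" "\<And>i. i < M \<Longrightarrow> A \<in> \<P> i \<Longrightarrow> i = q"
      using cover[OF A(1)] by blast
    have AT: "A - {k} \<in> \<T>" if "k \<in> A" for k using that AK by (auto simp: \<T>_def)
    have low: "P j k = Some s \<longleftrightarrow> k \<in> A \<and> j = \<rho> (A - {k})" if "j < n" "k < K" for j k
    proof -
      have "P j k = Some s \<longleftrightarrow> k \<notin> e j \<and> insert k (e j) = A"
        using that idx_eq[OF insertS A(1)] by (auto simp: P_def A(2))
      also have "\<dots> \<longleftrightarrow> k \<in> A \<and> e j = A - {k}" by blast
      also have "\<dots> \<longleftrightarrow> k \<in> A \<and> j = \<rho> (A - {k})"
      proof (rule conj_cong[OF refl], rule iffI)
        show "j = \<rho> (A - {k})" if "e j = A - {k}" using e(2)[OF \<open>j < n\<close>] that by simp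
        show "e j = A - {k}" if "k \<in> A" "j = \<rho> (A - {k})" using \<rho>n(2)[OF AT[OF that(1)]] that(2) by simp
      qed
      finally show ?thesis .
    qed
    have high: "P j k = Some s \<longleftrightarrow> k \<in> A \<and> j = n + q" if "\<not> j < n" "j < n + M" "k < K" for j k
    proof -
      have jM: "j - n < M" using that by linarith
      have "P j k = Some s \<longleftrightarrow> blk (j - n) k = A"
        using that idx_eq[OF blkS[OF jM that(3)] A(1)] by (simp add: P_def A(2))
      also have "\<dots> \<longleftrightarrow> k \<in> A \<and> A \<in> \<P> (j - n)"
        using blk[OF jM that(3)] blk_eq[OF jM that(3)] by blast
      also have "A \<in> \<P> (j - n) \<longleftrightarrow> j - n = q" using q jM by blast
      also have "\<dots> \<longleftrightarrow> j = n + q" using that(1) by linarith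
      finally show ?thesis .
    qed
    have cell: "P j k = Some s \<longleftrightarrow> k \<in> A \<and> (j = n + q \<or> j = \<rho> (A - {k}))"
      if "j < n + M" "k < K" for j k
      using low[of j k] high[of j k] \<rho>n(1)[OF AT[of k]] that by (cases "j < n") auto
    have cols: "columns_of K (n + M) P s = A"
    proof (intro set_eqI iffI)
      fix k assume "k \<in> columns_of K (n + M) P s"
      then show "k \<in> A" using cell by (auto simp: columns_of_def)
    next
      fix k assume "k \<in> A"
      then have "n + q < n + M" "k < K" "P (n + q) k = Some s" using cell[of "n + q" k] q(1) AK(1) by auto
      then show "k \<in> columns_of K (n + M) P s" unfolding columns_of_def by blast
    qed
    have \<rho>M: "\<rho> (A - {k}) < n + M" if "k \<in> A" for k using \<rho>n(1)[OF AT[OF that]] by simp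
    have rows: "rows_of K (n + M) P s = insert (n + q) ((\<lambda>k. \<rho> (A - {k})) ` A)"
    proof (intro set_eqI iffI)
      fix j assume "j \<in> rows_of K (n + M) P s"
      then show "j \<in> insert (n + q) ((\<lambda>k. \<rho> (A - {k})) ` A)" using cell by (auto simp: rows_of_def)
    next
      fix j assume j: "j \<in> insert (n + q) ((\<lambda>k. \<rho> (A - {k})) ` A)"
      have "A \<noteq> {}" using AK(2) by auto
      then obtain k where k: "k \<in> A" "j = n + q \<or> j = \<rho> (A - {k})" using j by blast
      then have "j < n + M" "k < K" "P j k = Some s" using cell[of j k] q(1) AK(1) \<rho>M[of k] by auto
      then show "j \<in> rows_of K (n + M) P s" unfolding rows_of_def by blast
    qed
    have inj: "inj_on (\<lambda>k. \<rho> (A - {k})) A"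
    proof (rule inj_onI)
      fix k k' assume "k \<in> A" "k' \<in> A" "\<rho> (A - {k}) = \<rho> (A - {k'})"
      then have "A - {k} = A - {k'}" using \<rho>n(2)[OF AT] by metis
      then show "k = k'" using \<open>k \<in> A\<close> by blast
    qed
    obtain c where c: "bij_betw c {..<t + 1} A"
      using ex_bij_betw_nat_finite[OF AK(3)] AK(2) by (auto simp: atLeast0LessThan)
    \<comment> \<open>Index 0 is the partition row, and index \<open>i + 1\<close> is the row whose
      diagonal entry lies in column \<open>c i\<close>.\<close>
    define r where "r i = (case i of 0 \<Rightarrow> n + q | Suc i \<Rightarrow> \<rho> (A - {c i}))" for i
    have cA: "c i \<in> A" if "i < t + 1" for i using bij_betwE[OF c] that by simp
    have "bij_betw r {..<t + 1 + 1} (rows_of K (n + M) P s)"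
    proof -
      have split: "{..<t + 1 + 1} = insert 0 (Suc ` {..<t + 1})"
        using lessThan_Suc_eq_insert_0[of "t + 1"] by simp
      have "bij_betw (\<lambda>i. \<rho> (A - {c i})) {..<t + 1} ((\<lambda>k. \<rho> (A - {k})) ` A)"
        using bij_betw_trans[OF c inj_on_imp_bij_betw[OF inj]] by (simp add: comp_def)
      then have "bij_betw r (Suc ` {..<t + 1}) ((\<lambda>k. \<rho> (A - {k})) ` A)"
        by (auto simp: bij_betw_def inj_on_def r_def image_image)
      moreover have "bij_betw r {0} {n + q}" by (simp add: r_def)
      moreover have "{n + q} \<inter> (\<lambda>k. \<rho> (A - {k})) ` A = {}" using \<rho>n(1)[OF AT] by fastforce
      ultimately have "bij_betw r ({0} \<union> Suc ` {..<t + 1}) ({n + q} \<union> (\<lambda>k. \<rho> (A - {k})) ` A)"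
        by (intro bij_betw_combine)
      then show ?thesis unfolding rows split by simp
    qed
    moreover have "P (r 0) (c i) = Some s" if "i < t + 1" for i
      using cell[of "n + q" "c i"] cA[OF that] AK(1) q(1) by (auto simp: r_def)
    moreover have "P (r (i + 1)) (c i') = (if i = i' then Some s else None)"
      if "i < t + 1" "i' < t + 1" for i i'
    proof (cases "i = i'")
      case True
      then show ?thesis
        using cell[OF \<rho>M[OF cA[OF that(1)]], of "c i"] cA[OF that(1)] AK(1) by (auto simp: r_def)
    next
      case False
      then have "c i' \<in> A - {c i}"
        using bij_betw_imp_inj_on[OF c] that cA by (auto simp: inj_on_def)
      then show ?thesis using \<rho>n[OF AT[OF cA[OF that(1)]]] False by (simp add: r_def P_def)
    qed
    moreover have "4 \<le> card {(j, k). j < n + M \<and> k < K \<and> P j k = Some s}"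
    proof -
      have "{n + q} \<times> A \<union> (\<lambda>k. (\<rho> (A - {k}), k)) ` A \<subseteq> {(j, k). j < n + M \<and> k < K \<and> P j k = Some s}"
        using cell AK(1) q(1) \<rho>M by auto
      moreover have "finite {(j, k). j < n + M \<and> k < K \<and> P j k = Some s}"
        by (rule finite_subset[of _ "{..<n + M} \<times> {..<K}"]) auto
      ultimately have "card ({n + q} \<times> A \<union> (\<lambda>k. (\<rho> (A - {k}), k)) ` A)
          \<le> card {(j, k). j < n + M \<and> k < K \<and> P j k = Some s}" by (rule card_mono[rotated])
      moreover have "card ({n + q} \<times> A \<union> (\<lambda>k. (\<rho> (A - {k}), k)) ` A) = (t + 1) + (t + 1)"
      proof (subst card_Un_disjoint)
        show "{n + q} \<times> A \<inter> (\<lambda>k. (\<rho> (A - {k}), k)) ` A = {}" using \<rho>n(1)[OF AT] by fastforce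
        show "card ({n + q} \<times> A) + card ((\<lambda>k. (\<rho> (A - {k}), k)) ` A) = t + 1 + (t + 1)"
          using AK by (simp add: card_image inj_on_def card_cartesian_product_singleton)
      qed (use AK in auto)
      \<comment> \<open>The \<open>2 * (t + 1)\<close> occurrences are at least four because
        \<open>t\<close> is positive.\<close>
      ultimately show ?thesis using t(1) by linarith
    qed
    ultimately show ?thesis using c unfolding cols by blast
  qed
  have "0 < n" unfolding n_def using t by simp
  have "spda K (n + M) ((K - 1) choose (t - 1)) (K choose (t + 1)) P"
    unfolding spda_def using t \<open>0 < n\<close> range stars shape by (intro conjI allI impI) auto
  then show ?thesis unfolding n_def M_def by blast
qed

text \<open>Expresses all binomial coefficients through \<open>(K - 1) choose t\<close>, so that
  their ratios become rational functions of \<open>K\<close> and \<open>t\<close>.\<close>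

lemma choose_identities:
  assumes "0 < t" "t < K"
  shows "real (K - t) * ((K - 1) choose (t - 1)) = t * real ((K - 1) choose t)"
    and "real (K - t) * (K choose t) = K * real ((K - 1) choose t)"
    and "real (t + 1) * (K choose (t + 1)) = K * real ((K - 1) choose t)"
proof -
  obtain k u where K: "K = Suc k" and u: "t = Suc u" using assms by (metis gr0_implies_Suc gr_implies_not0 not0_implies_Suc)
  have 3: "(t + 1) * (K choose (t + 1)) = K * ((K - 1) choose t)"
    using Suc_times_binomial_eq[of k t] by (simp add: K mult.commute)
  have 2: "(K - t) * (K choose t) = K * ((K - 1) choose t)"
    using binomial_absorb_comp[of K t] by simp
  have 1: "(K - t) * ((K - 1) choose (t - 1)) = t * ((K - 1) choose t)"
  proof -
    have "t * ((K - 1) choose t) = k * ((k - 1) choose u)"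
      using Suc_times_binomial_eq[of "k - 1" u] assms by (cases k) (simp_all add: K u mult.commute del: binomial_Suc_Suc)
    moreover have "(K - t) * ((K - 1) choose (t - 1)) = k * ((k - 1) choose u)"
      using binomial_absorb_comp[of k u] by (simp add: K u)
    ultimately show ?thesis by simp
  qed
  show "real (K - t) * ((K - 1) choose (t - 1)) = t * real ((K - 1) choose t)"
    using 1 by (metis of_nat_mult)
  show "real (K - t) * (K choose t) = K * real ((K - 1) choose t)" using 2 by (metis of_nat_mult)
  show "real (t + 1) * (K choose (t + 1)) = K * real ((K - 1) choose t)" using 3 by (metis of_nat_mult)
qed

text \<open>Minimality is \<open>spda_symbols_bound\<close> taken at \<open>t\<close> itself. Since
  \<open>F - Z = 2 * c\<close>, its left side collapses to \<open>(t + 1) * (K * c)\<close>, which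
  is \<open>(t + 1)^2\<close> times \<open>K choose (t + 1)\<close>.\<close>

theorem ex_optimal_spda:
  assumes t: "0 < t" "t < K" and dvd: "(t + 1) dvd K"
  shows "\<exists>P. optimal_spda K ((K choose t) + ((K - 1) choose t)) ((K - 1) choose (t - 1)) (K choose (t + 1)) P"
proof -
  define c where "c = real ((K - 1) choose t)"
  note ids = choose_identities[OF t, folded c_def]
  have tK: "real (K - t) = real K - real t" "0 < real K - real t" using t by auto
  have "K choose (t + 1) \<le> S'"
    if "spda K ((K choose t) + ((K - 1) choose t)) ((K - 1) choose (t - 1)) S' P'" for S' P'
  proof -
    define Z where "Z = real ((K - 1) choose (t - 1))"
    have pascal: "real (K choose t) = Z + c"
      using t choose_reduce_nat[of K t] by (simp add: Z_def c_def)
    have "(K * (2 * real t + 1) - (real t)\<^sup>2) * (Z + c + c - Z) / 2 - (K - t)\<^sup>2 * Z \<le> (t + 1)\<^sup>2 * real S'"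
      using spda_symbols_bound[OF that, of t] pascal tK(1) by (simp add: Z_def c_def add.commute)
    moreover have "(K - t)\<^sup>2 * Z = (real K - t) * (t * c)"
      using ids(1) tK by (simp add: Z_def power2_eq_square)
    ultimately have "(t + 1) * (K * c) \<le> (t + 1)\<^sup>2 * real S'"
      by (simp add: algebra_simps power2_eq_square)
    moreover have "(real t + 1)\<^sup>2 * real (K choose (t + 1)) = (t + 1) * (K * c)"
      using ids(3) by (simp only: power2_eq_square mult.assoc of_nat_add of_nat_1)
    ultimately have "(real t + 1)\<^sup>2 * real (K choose (t + 1)) \<le> (real t + 1)\<^sup>2 * real S'"
      by (simp only: of_nat_add of_nat_1 of_nat_power)
    then show ?thesis by simp
  qed
  then show ?thesis using ex_spda[OF assms] unfolding optimal_spda_def by blast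
qed

section \<open>Conditional entropy and information on finite uniform spaces\<close>

lemma
  assumes "finite \<Omega>" "\<Omega> \<noteq> {}"
  shows information_space_uniform: "information_space (uniform_count_measure \<Omega>) 2"
    and simple_distributed_uniform: "simple_distributed (uniform_count_measure \<Omega>) f
      (\<lambda>x. card {\<omega> \<in> \<Omega>. f \<omega> = x} / card \<Omega>)"
proof -
  interpret prob_space "uniform_count_measure \<Omega>" by (rule prob_space_uniform_count_measure[OF assms])
  show "information_space (uniform_count_measure \<Omega>) 2" by standard simp
  show "simple_distributed (uniform_count_measure \<Omega>) f (\<lambda>x. card {\<omega> \<in> \<Omega>. f \<omega> = x} / card \<Omega>)"
  proof (rule simple_distributedI)
    show "simple_function (uniform_count_measure \<Omega>) f"
      using assms by (simp add: simple_function_def space_uniform_count_measure sets_uniform_count_measure)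
    show "card {\<omega> \<in> \<Omega>. f \<omega> = x} / card \<Omega>
        = measure (uniform_count_measure \<Omega>) (f -` {x} \<inter> space (uniform_count_measure \<Omega>))" for x
    proof -
      have "{\<omega> \<in> \<Omega>. f \<omega> = x} = f -` {x} \<inter> \<Omega>" by auto
      then show ?thesis
        using assms by (simp add: space_uniform_count_measure measure_uniform_count_measure)
    qed
  qed simp
qed

text \<open>If \<open>V\<close> determines \<open>U\<close>, then on the support the conditional
  probability of \<open>U\<close> given \<open>V\<close> is one and every logarithm
  vanishes.\<close>

lemma uniform_conditional_entropy_0:
  assumes "finite \<Omega>" "\<Omega> \<noteq> {}"
    and det: "\<And>\<omega> \<omega>'. \<omega> \<in> \<Omega> \<Longrightarrow> \<omega>' \<in> \<Omega> \<Longrightarrow> V \<omega> = V \<omega>' \<Longrightarrow> U \<omega> = U \<omega>'"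
  shows "prob_space.conditional_entropy (uniform_count_measure \<Omega>) 2
    (count_space (U ` space (uniform_count_measure \<Omega>)))
    (count_space (V ` space (uniform_count_measure \<Omega>))) U V = 0"
proof -
  interpret information_space "uniform_count_measure \<Omega>" 2
    by (rule information_space_uniform[OF assms(1,2)])
  note sd = simple_distributed_uniform[OF assms(1,2)]
  have "card {\<omega> \<in> \<Omega>. (U \<omega>, V \<omega>) = (U \<omega>0, V \<omega>0)} / card {\<omega> \<in> \<Omega>. V \<omega> = V \<omega>0} = 1"
    if "\<omega>0 \<in> \<Omega>" for \<omega>0
  proof -
    have "{\<omega> \<in> \<Omega>. (U \<omega>, V \<omega>) = (U \<omega>0, V \<omega>0)} = {\<omega> \<in> \<Omega>. V \<omega> = V \<omega>0}"
      unfolding prod.inject using det[OF _ that] by blast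
    moreover have "card {\<omega> \<in> \<Omega>. V \<omega> = V \<omega>0} \<noteq> 0" using that assms(1) by auto
    ultimately show ?thesis by simp
  qed
  then have "log 2 (card {\<omega> \<in> \<Omega>. (U \<omega>, V \<omega>) = p} / card \<Omega> / (card {\<omega> \<in> \<Omega>. V \<omega> = snd p} / card \<Omega>)) = 0"
    if "p \<in> (\<lambda>\<omega>. (U \<omega>, V \<omega>)) ` \<Omega>" for p
    using that assms(1,2) by (elim imageE) (simp only: snd_conv divide_divide_eq_left divide_divide_eq_right
      of_nat_eq_0_iff card_eq_0_iff simp_thms nonzero_mult_divide_mult_cancel_right log_one
      nonzero_mult_div_cancel_right times_divide_eq_left)
  then show ?thesis
    unfolding conditional_entropy_eq[OF sd sd]
    unfolding space_uniform_count_measure neg_equal_0_iff_equal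
    by (intro sum.neutral ballI) (simp only: case_prod_unfold prod.collapse mult_zero_right)
qed

text \<open>The hypothesis is conditional independence given \<open>T\<close>, in terms of counts
  and free of divisions; it makes each argument of the logarithm on the support equal to
  one.\<close>

lemma uniform_conditional_mutual_information_0:
  assumes "finite \<Omega>" "\<Omega> \<noteq> {}"
    and indep: "\<And>x y z. card {\<omega> \<in> \<Omega>. U \<omega> = x \<and> V \<omega> = y \<and> T \<omega> = z} * card {\<omega> \<in> \<Omega>. T \<omega> = z}
      = card {\<omega> \<in> \<Omega>. U \<omega> = x \<and> T \<omega> = z} * card {\<omega> \<in> \<Omega>. V \<omega> = y \<and> T \<omega> = z}"
  shows "prob_space.conditional_mutual_information (uniform_count_measure \<Omega>) 2
    (count_space (U ` space (uniform_count_measure \<Omega>)))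
    (count_space (V ` space (uniform_count_measure \<Omega>)))
    (count_space (T ` space (uniform_count_measure \<Omega>))) U V T = 0"
proof -
  interpret information_space "uniform_count_measure \<Omega>" 2
    by (rule information_space_uniform[OF assms(1,2)])
  note sd = simple_distributed_uniform[OF assms(1,2)]
  let ?c = "real (card \<Omega>)"
  have "(card {\<omega> \<in> \<Omega>. (U \<omega>, V \<omega>, T \<omega>) = (U \<omega>0, V \<omega>0, T \<omega>0)} / ?c) /
      ((card {\<omega> \<in> \<Omega>. (U \<omega>, T \<omega>) = (U \<omega>0, T \<omega>0)} / ?c) *
       ((card {\<omega> \<in> \<Omega>. (V \<omega>, T \<omega>) = (V \<omega>0, T \<omega>0)} / ?c) / (card {\<omega> \<in> \<Omega>. T \<omega> = T \<omega>0} / ?c))) = 1"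
    if w: "\<omega>0 \<in> \<Omega>" for \<omega>0
  proof -
    let ?xyz = "card {\<omega> \<in> \<Omega>. U \<omega> = U \<omega>0 \<and> V \<omega> = V \<omega>0 \<and> T \<omega> = T \<omega>0}"
    let ?xz = "card {\<omega> \<in> \<Omega>. U \<omega> = U \<omega>0 \<and> T \<omega> = T \<omega>0}"
    let ?yz = "card {\<omega> \<in> \<Omega>. V \<omega> = V \<omega>0 \<and> T \<omega> = T \<omega>0}"
    let ?z = "card {\<omega> \<in> \<Omega>. T \<omega> = T \<omega>0}"
    have "real ?xyz * real ?z = real ?xz * real ?yz"
      by (simp only: of_nat_mult[symmetric] indep)
    moreover have "?c \<noteq> 0" using assms(1,2) by simp
    moreover have "?xz \<noteq> 0" "?yz \<noteq> 0" "?z \<noteq> 0" using w assms(1) by auto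
    ultimately show ?thesis by (simp add: field_simps)
  qed
  then have "log 2 ((card {\<omega> \<in> \<Omega>. (U \<omega>, V \<omega>, T \<omega>) = p} / ?c) /
      ((card {\<omega> \<in> \<Omega>. (U \<omega>, T \<omega>) = (fst p, snd (snd p))} / ?c) *
       ((card {\<omega> \<in> \<Omega>. (V \<omega>, T \<omega>) = snd p} / ?c) / (card {\<omega> \<in> \<Omega>. T \<omega> = snd (snd p)} / ?c)))) = 0"
    if "p \<in> (\<lambda>\<omega>. (U \<omega>, V \<omega>, T \<omega>)) ` \<Omega>" for p
    using that by (elim imageE) (simp only: fst_conv snd_conv log_one)
  then show ?thesis
    unfolding conditional_mutual_information_eq[OF sd sd sd sd]
    unfolding space_uniform_count_measure
    by (intro sum.neutral ballI) (simp only: case_prod_unfold prod.collapse mult_zero_right)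
qed

text \<open>Within a fibre of \<open>T\<close> the injection shows that no value of \<open>V\<close>
  is rarer under the second value of \<open>U\<close> than under the first. Exchanging the two
  values gives equality, so injectivity of \<open>h\<close> is enough.\<close>

lemma uniform_conditional_mutual_information_symmetric:
  assumes fin: "finite \<Omega>" and ne: "\<Omega> \<noteq> {}"
    and sym: "\<And>\<omega>0 \<omega>1. \<omega>0 \<in> \<Omega> \<Longrightarrow> \<omega>1 \<in> \<Omega> \<Longrightarrow> T \<omega>0 = T \<omega>1 \<Longrightarrow>
      \<exists>h. inj_on h {\<omega> \<in> \<Omega>. U \<omega> = U \<omega>0 \<and> T \<omega> = T \<omega>0} \<and>
        (\<forall>\<omega>\<in>\<Omega>. U \<omega> = U \<omega>0 \<and> T \<omega> = T \<omega>0 \<longrightarrow>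
          h \<omega> \<in> \<Omega> \<and> U (h \<omega>) = U \<omega>1 \<and> V (h \<omega>) = V \<omega> \<and> T (h \<omega>) = T \<omega>)"
  shows "prob_space.conditional_mutual_information (uniform_count_measure \<Omega>) 2
    (count_space (U ` space (uniform_count_measure \<Omega>)))
    (count_space (V ` space (uniform_count_measure \<Omega>)))
    (count_space (T ` space (uniform_count_measure \<Omega>))) U V T = 0"
proof (rule uniform_conditional_mutual_information_0[OF fin ne])
  fix x y z
  define \<X> where "\<X> = U ` {\<omega> \<in> \<Omega>. T \<omega> = z}"
  \<comment> \<open>The predicate \<open>Q\<close> treats the event that \<open>V\<close> equals
    \<open>y\<close> and the trivial event in one argument.\<close>
  let ?c = "\<lambda>Q x. card {\<omega> \<in> \<Omega>. U \<omega> = x \<and> Q (V \<omega>) \<and> T \<omega> = z}"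
  have finX: "finite \<X>" using fin by (simp add: \<X>_def)
  have le: "?c Q x0 \<le> ?c Q x1" if x: "x0 \<in> \<X>" "x1 \<in> \<X>" for Q x0 x1
  proof -
    obtain \<omega>0 \<omega>1 where w: "\<omega>0 \<in> \<Omega>" "T \<omega>0 = z" "x0 = U \<omega>0" "\<omega>1 \<in> \<Omega>" "T \<omega>1 = z" "x1 = U \<omega>1"
      using x unfolding \<X>_def by blast
    then obtain h where h: "inj_on h {\<omega> \<in> \<Omega>. U \<omega> = x0 \<and> T \<omega> = z}"
      "\<And>\<omega>. \<omega> \<in> \<Omega> \<Longrightarrow> U \<omega> = x0 \<Longrightarrow> T \<omega> = z \<Longrightarrow>
        h \<omega> \<in> \<Omega> \<and> U (h \<omega>) = x1 \<and> V (h \<omega>) = V \<omega> \<and> T (h \<omega>) = z"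
      using sym[of \<omega>0 \<omega>1] by auto
    show ?thesis
    proof (rule card_inj_on_le)
      show "inj_on h {\<omega> \<in> \<Omega>. U \<omega> = x0 \<and> Q (V \<omega>) \<and> T \<omega> = z}"
        by (rule inj_on_subset[OF h(1)]) blast
      show "h ` {\<omega> \<in> \<Omega>. U \<omega> = x0 \<and> Q (V \<omega>) \<and> T \<omega> = z}
          \<subseteq> {\<omega> \<in> \<Omega>. U \<omega> = x1 \<and> Q (V \<omega>) \<and> T \<omega> = z}"
        using h(2) by (intro image_subsetI) simp
    qed (use fin in simp)
  qed
  have total: "card {\<omega> \<in> \<Omega>. Q (V \<omega>) \<and> T \<omega> = z} = card \<X> * ?c Q x" if "x \<in> \<X>" for Q
  proof -
    have "card {\<omega> \<in> \<Omega>. Q (V \<omega>) \<and> T \<omega> = z} = (\<Sum>\<omega>\<in>{\<omega> \<in> \<Omega>. Q (V \<omega>) \<and> T \<omega> = z}. 1)" by simp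
    also have "\<dots> = (\<Sum>x\<in>\<X>. \<Sum>\<omega>\<in>{\<omega> \<in> {\<omega> \<in> \<Omega>. Q (V \<omega>) \<and> T \<omega> = z}. U \<omega> = x}. 1)"
      by (rule sum.group[symmetric]) (use fin finX in \<open>auto simp: \<X>_def\<close>)
    also have "\<dots> = (\<Sum>x'\<in>\<X>. ?c Q x)"
    proof (rule sum.cong[OF refl])
      fix x' assume "x' \<in> \<X>"
      then have "?c Q x' = ?c Q x" using that le by (intro antisym)
      moreover have "{\<omega> \<in> {\<omega> \<in> \<Omega>. Q (V \<omega>) \<and> T \<omega> = z}. U \<omega> = x'}
          = {\<omega> \<in> \<Omega>. U \<omega> = x' \<and> Q (V \<omega>) \<and> T \<omega> = z}" by blast
      ultimately show "(\<Sum>\<omega>\<in>{\<omega> \<in> {\<omega> \<in> \<Omega>. Q (V \<omega>) \<and> T \<omega> = z}. U \<omega> = x'}. 1) = ?c Q x" by simp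
    qed
    finally show ?thesis by simp
  qed
  show "card {\<omega> \<in> \<Omega>. U \<omega> = x \<and> V \<omega> = y \<and> T \<omega> = z} * card {\<omega> \<in> \<Omega>. T \<omega> = z}
      = card {\<omega> \<in> \<Omega>. U \<omega> = x \<and> T \<omega> = z} * card {\<omega> \<in> \<Omega>. V \<omega> = y \<and> T \<omega> = z}"
  proof (cases "x \<in> \<X>")
    case True
    show ?thesis using total[OF True, of "\<lambda>v. v = y"] total[OF True, of "\<lambda>v. True"] by simp
  next
    case False
    then have "{\<omega> \<in> \<Omega>. U \<omega> = x \<and> V \<omega> = y \<and> T \<omega> = z} = {}" "{\<omega> \<in> \<Omega>. U \<omega> = x \<and> T \<omega> = z} = {}"
      unfolding \<X>_def by blast+
    then show ?thesis by (simp only: card.empty mult_0)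
  qed
qed

section \<open>The caching scheme of an array\<close>

text \<open>The images of \<open>p\<close> and \<open>q\<close> have complements of equal size in
  \<open>C\<close>, so the partial bijection from \<open>p i\<close> to \<open>q i\<close> can be
  completed arbitrarily.\<close>

lemma ex_permutes_extending:
  assumes "finite C" "inj_on p I" "inj_on q I" "p ` I \<subseteq> C" "q ` I \<subseteq> C"
  shows "\<exists>\<sigma>. \<sigma> permutes C \<and> (\<forall>i\<in>I. \<sigma> (p i) = q i)"
proof -
  have "card (C - p ` I) = card (C - q ` I)"
    using assms by (simp add: card_Diff_subset finite_subset card_image)
  then obtain h where h: "bij_betw h (C - p ` I) (C - q ` I)"
    using finite_same_card_bij[of "C - p ` I" "C - q ` I"] assms(1) by blast
  define \<sigma> where "\<sigma> x = (if x \<in> p ` I then q (the_inv_into I p x) else if x \<in> C then h x else x)" for x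
  have \<sigma>p: "\<sigma> (p i) = q i" if "i \<in> I" for i
    using that assms(2) by (simp add: \<sigma>_def the_inv_into_f_f)
  have "bij_betw \<sigma> (p ` I) (q ` I)"
  proof -
    have "bij_betw (q \<circ> the_inv_into I p) (p ` I) (q ` I)"
      by (rule bij_betw_trans[OF bij_betw_the_inv_into]) (use assms in \<open>auto simp: bij_betw_def\<close>)
    then show ?thesis by (rule bij_betw_cong[THEN iffD1, rotated]) (simp add: \<sigma>_def)
  qed
  moreover have "bij_betw \<sigma> (C - p ` I) (C - q ` I)"
    using h by (rule bij_betw_cong[THEN iffD1, rotated]) (auto simp: \<sigma>_def)
  ultimately have "bij_betw \<sigma> (p ` I \<union> (C - p ` I)) (q ` I \<union> (C - q ` I))"
    by (rule bij_betw_combine) blast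
  moreover have "p ` I \<union> (C - p ` I) = C" "q ` I \<union> (C - q ` I) = C" using assms by auto
  ultimately have "\<sigma> permutes C"
    using assms(4) by (intro bij_imp_permutes) (auto simp: \<sigma>_def)
  then show ?thesis using \<sigma>p by blast
qed

section \<open>Bitwise XOR\<close>

lemma length_big_xor [simp]: "length (big_xor L A f) = L"
  by (simp add: big_xor_def)

lemma length_xor_bits [simp]: "length (xor_bits u v) = min (length u) (length v)"
  by (simp add: xor_bits_def)

lemma nth_xor_bits: "i < length u \<Longrightarrow> i < length v \<Longrightarrow> xor_bits u v ! i \<longleftrightarrow> u ! i \<noteq> v ! i"
  by (simp add: xor_bits_def)

lemma nth_big_xor: "i < L \<Longrightarrow> big_xor L A f ! i \<longleftrightarrow> odd (card {a \<in> A. f a ! i})"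
  by (simp add: big_xor_def)

lemma xor_bits_cancel:
  assumes "xor_bits u v = xor_bits u v'" "length v = length u" "length v' = length u"
  shows "v = v'"
  using assms nth_xor_bits[of _ u v] nth_xor_bits[of _ u v'] by (intro nth_equalityI) auto

lemma big_xor_cong:
  assumes "A = A'" "\<And>a. a \<in> A' \<Longrightarrow> f a = g a"
  shows "big_xor L A f = big_xor L A' g"
proof -
  have "{a \<in> A. f a ! i} = {a \<in> A'. g a ! i}" for i using assms by auto
  then show ?thesis by (simp add: big_xor_def)
qed

lemma big_xor_union:
  assumes "finite A" "finite A'" "A \<inter> A' = {}"
  shows "xor_bits (big_xor L A f) (big_xor L A' f) = big_xor L (A \<union> A') f"
proof (rule nth_equalityI)
  fix i assume "i < length (xor_bits (big_xor L A f) (big_xor L A' f))"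
  then have i: "i < L" by simp
  have "{a \<in> A \<union> A'. f a ! i} = {a \<in> A. f a ! i} \<union> {a \<in> A'. f a ! i}" by blast
  moreover have "card ({a \<in> A. f a ! i} \<union> {a \<in> A'. f a ! i}) = card {a \<in> A. f a ! i} + card {a \<in> A'. f a ! i}"
    using assms by (intro card_Un_disjoint) auto
  ultimately show "xor_bits (big_xor L A f) (big_xor L A' f) ! i = big_xor L (A \<union> A') f ! i"
    using i by (auto simp: nth_xor_bits nth_big_xor)
qed simp

lemma big_xor_image:
  assumes "inj_on h A"
  shows "big_xor L (h ` A) f = big_xor L A (f \<circ> h)"
proof -
  have "card {b \<in> h ` A. f b ! i} = card {a \<in> A. (f \<circ> h) a ! i}" for i
  proof -
    have "{b \<in> h ` A. f b ! i} = h ` {a \<in> A. (f \<circ> h) a ! i}" by auto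
    then show ?thesis using inj_on_subset[OF assms] by (simp add: card_image)
  qed
  then show ?thesis by (simp add: big_xor_def)
qed

text \<open>A sum over the two-element field determines one summand once the others are known; this
  is the decoding step.\<close>

lemma big_xor_insert_cancel:
  assumes "finite A" "a \<in> A" "big_xor L A f = big_xor L A g"
    and "\<And>b. b \<in> A \<Longrightarrow> b \<noteq> a \<Longrightarrow> f b = g b" "length (f a) = L" "length (g a) = L"
  shows "f a = g a"
proof (rule nth_equalityI)
  fix i assume "i < length (f a)"
  then have i: "i < L" using assms(5) by simp
  have split: "odd (card {b \<in> A. u b ! i}) \<longleftrightarrow> (odd (card {b \<in> A - {a}. u b ! i}) \<noteq> u a ! i)" for u :: "'a \<Rightarrow> bool list"
  proof (cases "u a ! i")
    case True
    then have "{b \<in> A. u b ! i} = insert a {b \<in> A - {a}. u b ! i}" using assms(2) by auto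
    then show ?thesis using True assms(1) by simp
  next
    case False
    then have "{b \<in> A. u b ! i} = {b \<in> A - {a}. u b ! i}" by auto
    then show ?thesis using False by simp
  qed
  have "{b \<in> A - {a}. f b ! i} = {b \<in> A - {a}. g b ! i}" using assms(4) by auto
  moreover have "odd (card {b \<in> A. f b ! i}) \<longleftrightarrow> odd (card {b \<in> A. g b ! i})"
    using arg_cong[OF assms(3), of "\<lambda>w. w ! i"] i by (simp add: nth_big_xor)
  ultimately show "f a ! i = g a ! i" unfolding split by auto
qed (use assms in simp)

section \<open>Cached and diagonal rows of a user\<close>

text \<open>\<open>Z_less\<close> leaves a non-star cell in each column, so every user sees at least
  one header, from which decoding identifies the requested file.\<close>

locale spda_caching = array_caching +
  fixes Z :: nat
  assumes spda: "spda K F Z S P" and KN: "K \<le> N" and B_pos: "0 < B" and F_dvd: "F dvd B"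
    and Z_less: "Z < F"
begin

abbreviation L :: nat where "L \<equiv> B div F"

lemma F_pos: "0 < F"
  using spda by (auto simp: spda_def)

lemma B_eq: "B = F * L"
  using F_dvd by simp

lemma L_pos: "0 < L"
  using B_pos B_eq by (metis mult_0_right neq0_conv)

lemma finite_outcomes: "finite outcomes"
proof -
  let ?D = "({..<N} \<rightarrow>\<^sub>E {w::bool list. length w = B}) \<times> ({..<N} \<rightarrow>\<^sub>E {\<pi>. \<pi> permutes {..<F}}) \<times>
    ({..<S} \<rightarrow>\<^sub>E {w::bool list. length w = L}) \<times> ({..<K} \<rightarrow>\<^sub>E {..<N})"
  have words: "finite {w::bool list. length w = n}" for n
    using finite_lists_length_eq[of "UNIV :: bool set" n] by simp
  have "finite ?D"
    by (intro finite_cartesian_product finite_PiE words finite_permutations) auto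
  moreover have "outcomes \<subseteq> (\<lambda>(f, l, \<kappa>, d). Outcome f l \<kappa> d) ` ?D"
  proof
    fix \<omega> assume "\<omega> \<in> outcomes"
    then show "\<omega> \<in> (\<lambda>(f, l, \<kappa>, d). Outcome f l \<kappa> d) ` ?D"
      by (intro image_eqI[of _ _ "(file_of \<omega>, label_of \<omega>, key_of \<omega>, demand_of \<omega>)"])
         (auto simp: outcomes_def)
  qed
  ultimately show ?thesis by (rule finite_surj)
qed

lemma outcomes_nonempty: "outcomes \<noteq> {}"
proof -
  have "Outcome (\<lambda>n\<in>{..<N}. replicate B False) (\<lambda>n\<in>{..<N}. id) (\<lambda>s\<in>{..<S}. replicate L False)
      (\<lambda>k\<in>{..<K}. k) \<in> outcomes"
    using KN by (auto simp: outcomes_def inj_on_def)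
  then show ?thesis by blast
qed

text \<open>The point is that the definite description in \<open>repeated_row\<close> denotes
  \<open>j0\<close>: another row with \<open>s\<close> in two columns would be the diagonal row of
  one of them and hold a star in the other.\<close>

lemma rep_structure:
  assumes s: "s < S"
  shows "\<exists>\<delta>. rep s < F \<and> (\<forall>k\<in>\<U> s. P (rep s) k = Some s) \<and>
    (\<forall>k\<in>\<U> s. \<delta> k < F \<and> \<delta> k \<noteq> rep s \<and> P (\<delta> k) k = Some s \<and>
      (\<forall>k'\<in>\<U> s. k \<noteq> k' \<longrightarrow> P (\<delta> k) k' = None) \<and>
      (\<forall>j<F. P j k = Some s \<longrightarrow> j = rep s \<or> j = \<delta> k))"
proof -
  obtain j0 \<delta> where d: "j0 < F" "\<And>k. k \<in> \<U> s \<Longrightarrow> P j0 k = Some s"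
    "\<And>k. k \<in> \<U> s \<Longrightarrow> \<delta> k < F \<and> \<delta> k \<noteq> j0 \<and> P (\<delta> k) k = Some s"
    "\<And>k k'. k \<in> \<U> s \<Longrightarrow> k' \<in> \<U> s \<Longrightarrow> k \<noteq> k' \<Longrightarrow> P (\<delta> k) k' = None"
    "\<And>j k. j < F \<Longrightarrow> k < K \<Longrightarrow> P j k = Some s \<Longrightarrow> j = j0 \<or> j = \<delta> k"
    "2 \<le> card (\<U> s)"
    by (rule spda_symbolE[OF spda s]) (rule that)
  have "rep s = j0"
    unfolding repeated_row_def
  proof (rule the_equality)
    have "{k. k < K \<and> P j0 k = Some s} = \<U> s" using d(1,2) by (auto simp: columns_of_iff)
    then show "j0 < F \<and> 2 \<le> card {k. k < K \<and> P j0 k = Some s}" using d(1,6) by simp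
  next
    fix j assume j: "j < F \<and> 2 \<le> card {k. k < K \<and> P j k = Some s}"
    show "j = j0"
    proof (rule ccontr)
      assume ne: "j \<noteq> j0"
      have "k = k'" if k: "k < K" "P j k = Some s" "k' < K" "P j k' = Some s" for k k'
      proof (rule ccontr)
        assume "k \<noteq> k'"
        moreover have "k \<in> \<U> s" "k' \<in> \<U> s" using k j by (auto simp: columns_of_iff)
        moreover have "j = \<delta> k" using d(5)[of j k] j k ne by blast
        ultimately show False using d(4)[of k k'] k by simp
      qed
      then have "card {k. k < K \<and> P j k = Some s} \<le> Suc 0"
        by (subst card_le_Suc0_iff_eq) auto
      then show False using j by linarith
    qed
  qed
  moreover have "k < K" if "k \<in> \<U> s" for k using that by (simp add: columns_of_iff)
  ultimately show ?thesis using d(1-5) by (intro exI[of _ \<delta>] conjI ballI allI impI) blast+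
qed

text \<open>The row of the diagonal cell of \<open>s\<close> in column \<open>k\<close>. It is
  uniquely determined for columns in \<open>\<U> s\<close> and arbitrary elsewhere.\<close>

definition diag :: "nat \<Rightarrow> nat \<Rightarrow> nat" where
  "diag s = (SOME \<delta>. \<forall>k\<in>\<U> s. \<delta> k < F \<and> \<delta> k \<noteq> rep s \<and> P (\<delta> k) k = Some s \<and>
      (\<forall>k'\<in>\<U> s. k \<noteq> k' \<longrightarrow> P (\<delta> k) k' = None) \<and>
      (\<forall>j<F. P j k = Some s \<longrightarrow> j = rep s \<or> j = \<delta> k))"

lemma rep_less: "s < S \<Longrightarrow> rep s < F"
  and rep_cell: "s < S \<Longrightarrow> k \<in> \<U> s \<Longrightarrow> P (rep s) k = Some s"
  using rep_structure by blast+

lemma diag_props: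
  assumes "s < S"
  shows "\<forall>k\<in>\<U> s. diag s k < F \<and> diag s k \<noteq> rep s \<and> P (diag s k) k = Some s \<and>
      (\<forall>k'\<in>\<U> s. k \<noteq> k' \<longrightarrow> P (diag s k) k' = None) \<and>
      (\<forall>j<F. P j k = Some s \<longrightarrow> j = rep s \<or> j = diag s k)"
proof -
  have "\<exists>\<delta>. \<forall>k\<in>\<U> s. \<delta> k < F \<and> \<delta> k \<noteq> rep s \<and> P (\<delta> k) k = Some s \<and>
      (\<forall>k'\<in>\<U> s. k \<noteq> k' \<longrightarrow> P (\<delta> k) k' = None) \<and>
      (\<forall>j<F. P j k = Some s \<longrightarrow> j = rep s \<or> j = \<delta> k)"
    using rep_structure[OF assms] by (elim exE conjE) (rule exI)
  then show ?thesis unfolding diag_def by (rule someI_ex)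
qed

lemma
  assumes "s < S" "k \<in> \<U> s"
  shows diag_less: "diag s k < F" and diag_neq_rep: "diag s k \<noteq> rep s"
    and diag_cell: "P (diag s k) k = Some s"
    and diag_star: "k' \<in> \<U> s \<Longrightarrow> k \<noteq> k' \<Longrightarrow> P (diag s k) k' = None"
    and cell_cases: "j < F \<Longrightarrow> P j k = Some s \<Longrightarrow> j = rep s \<or> j = diag s k"
  using diag_props[OF assms(1)] assms(2) by blast+

lemma symbol_less: "j < F \<Longrightarrow> k < K \<Longrightarrow> P j k = Some s \<Longrightarrow> s < S"
  using spda by (auto simp: spda_def)

lemma symbols_of_iff: "k < K \<Longrightarrow> s \<in> symbols_of k \<longleftrightarrow> s < S \<and> (\<exists>j<F. P j k = Some s)"
  by (auto simp: symbols_of_def columns_of_iff)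

lemma symbols_ofD: "s \<in> symbols_of k \<Longrightarrow> s < S \<and> k \<in> \<U> s \<and> k < K"
  by (auto simp: symbols_of_def columns_of_iff)

lemma finite_symbols_of: "finite (symbols_of k)"
  by (rule finite_subset[of _ "{..<S}"]) (auto simp: symbols_of_def)

lemma demanded_cells_eq:
  assumes "s < S"
  shows "demanded_cells s = (\<lambda>k. (k, diag s k)) ` \<U> s"
proof -
  have "j < F \<and> j \<noteq> rep s \<and> P j k = Some s \<longleftrightarrow> j = diag s k" if "k \<in> \<U> s" for j k
    using diag_less[OF assms that] diag_neq_rep[OF assms that] diag_cell[OF assms that]
      cell_cases[OF assms that] by metis
  then show ?thesis unfolding demanded_cells_def by auto
qed

text \<open>A user caches the same positions of every file, so one set of rows describes the
  cache.\<close>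

definition cached_rows :: "nat \<Rightarrow> nat set" where
  "cached_rows k = {j. j < F \<and> P j k = None} \<union> rep ` symbols_of k"

lemma cached_rows_less: "j \<in> cached_rows k \<Longrightarrow> j < F"
  using rep_less by (auto simp: cached_rows_def symbols_of_def)

lemma cache_eq:
  assumes "k < K"
  shows "cache k \<omega> = (\<lambda>(n, j). labelled n j \<omega>) ` ({..<N} \<times> cached_rows k)"
proof -
  have "s < S \<and> P (rep s) k = Some s \<longleftrightarrow> s \<in> symbols_of k" for s
    using assms rep_less rep_cell by (auto simp: symbols_of_def columns_of_iff)
  then have rep: "{labelled n (rep s) \<omega> | n s. n < N \<and> s < S \<and> P (rep s) k = Some s}
      = {labelled n (rep s) \<omega> | n s. n < N \<and> s \<in> symbols_of k}"
    by simp
  show ?thesis unfolding cache_def cached_rows_def rep by (auto 0 3)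
qed

text \<open>The diagonal cell is no star. If its row were the repeated row of some symbol of
  \<open>k\<close>, the entry in column \<open>k\<close> would force that symbol to be
  \<open>s\<close>, against \<open>diag_neq_rep\<close>.\<close>

lemma diag_notin_cached_rows:
  assumes "s \<in> symbols_of k"
  shows "diag s k \<notin> cached_rows k"
proof
  note s = symbols_ofD[OF assms]
  assume "diag s k \<in> cached_rows k"
  then obtain s' where s': "s' \<in> symbols_of k" "diag s k = rep s'"
    using diag_cell[of s k] s by (auto simp: cached_rows_def)
  then have "s = s'" using diag_cell[of s k] rep_cell[of s' k] symbols_ofD[OF s'(1)] s by simp
  then show False using s' diag_neq_rep[of s k] s by simp
qed

lemma row_cases:
  assumes "k < K" "j < F"
  obtains "j \<in> cached_rows k" | s where "s \<in> symbols_of k" "j = diag s k"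
proof (cases "P j k")
  case None
  then show ?thesis using assms that(1) by (simp add: cached_rows_def)
next
  case (Some s)
  then have "s \<in> symbols_of k" using assms symbol_less by (auto simp: symbols_of_iff)
  then show ?thesis using that cell_cases[of s k j] symbols_ofD[of s k] Some assms
    by (auto simp: cached_rows_def)
qed

lemma rep_inj: "inj_on rep (symbols_of k)"
proof (rule inj_onI)
  fix s s' assume "s \<in> symbols_of k" "s' \<in> symbols_of k" "rep s = rep s'"
  then show "s = s'" by (metis rep_cell symbols_ofD option.inject)
qed

lemma card_cached_rows:
  assumes "k < K"
  shows "card (cached_rows k) = Z + card (symbols_of k)"
proof -
  have "P (rep s) k = Some s" if "s \<in> symbols_of k" for s
    using rep_cell[of s k] symbols_ofD[OF that] by simp
  then have "{j. j < F \<and> P j k = None} \<inter> rep ` symbols_of k = {}" by force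
  then have "card (cached_rows k) = card {j. j < F \<and> P j k = None} + card (rep ` symbols_of k)"
    unfolding cached_rows_def using finite_symbols_of by (intro card_Un_disjoint) simp_all
  then show ?thesis using spda assms by (simp add: card_image rep_inj spda_def)
qed

text \<open>Besides its stars, column \<open>k\<close> has for each of its symbols one repeated and
  one diagonal row.\<close>

lemma card_symbols_of:
  assumes "k < K"
  shows "2 * card (symbols_of k) + Z = F"
proof -
  have inj: "inj_on (\<lambda>s. diag s k) (symbols_of k)"
  proof (rule inj_onI)
    fix s s' assume "s \<in> symbols_of k" "s' \<in> symbols_of k" "diag s k = diag s' k"
    then show "s = s'" by (metis diag_cell symbols_ofD option.inject)
  qed
  have "{..<F} = cached_rows k \<union> (\<lambda>s. diag s k) ` symbols_of k"
    using row_cases[OF assms] cached_rows_less diag_less symbols_ofD by blast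
  then have "F = card (cached_rows k \<union> (\<lambda>s. diag s k) ` symbols_of k)" by (metis card_lessThan)
  also have "\<dots> = card (cached_rows k) + card ((\<lambda>s. diag s k) ` symbols_of k)"
  proof (rule card_Un_disjoint)
    show "finite (cached_rows k)" by (rule finite_subset[of _ "{..<F}"]) (auto dest: cached_rows_less)
    show "cached_rows k \<inter> (\<lambda>s. diag s k) ` symbols_of k = {}" using diag_notin_cached_rows by blast
  qed (simp add: finite_symbols_of)
  finally show ?thesis using card_cached_rows[OF assms] by (simp add: card_image inj)
qed

lemma symbols_of_nonempty: "k < K \<Longrightarrow> symbols_of k \<noteq> {}"
  using card_symbols_of[of k] Z_less by auto

section \<open>Demand vectors and the positions used in a transmission\<close>

definition valid_demand :: "(nat \<Rightarrow> nat) \<Rightarrow> bool" where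
  "valid_demand d \<longleftrightarrow> d \<in> {..<K} \<rightarrow>\<^sub>E {..<N} \<and> inj_on d {..<K}"

lemma outcomesD:
  assumes "\<omega> \<in> outcomes"
  shows "valid_demand (demand_of \<omega>)"
    and "n < N \<Longrightarrow> length (file_of \<omega> n) = B"
    and "n < N \<Longrightarrow> label_of \<omega> n permutes {..<F}"
    and "s < S \<Longrightarrow> length (key_of \<omega> s) = L"
  using assms by (auto simp: outcomes_def valid_demand_def PiE_iff)

lemma valid_demand_less: "valid_demand d \<Longrightarrow> k < K \<Longrightarrow> d k < N"
  by (auto simp: valid_demand_def PiE_iff)

lemma valid_demand_eq_iff: "valid_demand d \<Longrightarrow> k < K \<Longrightarrow> k' < K \<Longrightarrow> d k = d k' \<longleftrightarrow> k = k'"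
  by (auto simp: valid_demand_def inj_on_def)

lemma inj_on_column: "valid_demand d \<Longrightarrow> inj_on d (\<U> s)"
  by (auto simp: valid_demand_def inj_on_def columns_of_iff)

text \<open>The position in file \<open>n\<close> of its unique packet in \<open>X\<^sub>s\<close>, under the demand vector \<open>d\<close>.\<close>

definition pos :: "nat \<Rightarrow> (nat \<Rightarrow> nat) \<Rightarrow> nat \<Rightarrow> nat" where
  "pos s d n = (if n \<in> d ` \<U> s then diag s (the_inv_into (\<U> s) d n) else rep s)"

lemma pos_demanded: "valid_demand d \<Longrightarrow> k \<in> \<U> s \<Longrightarrow> pos s d (d k) = diag s k"
  by (simp add: pos_def the_inv_into_f_f inj_on_column)

lemma pos_other: "n \<notin> d ` \<U> s \<Longrightarrow> pos s d n = rep s"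
  by (simp add: pos_def)

lemma pos_less:
  assumes "valid_demand d" "s < S"
  shows "pos s d n < F"
  using assms pos_demanded[OF assms(1)] diag_less[of s] rep_less[of s] pos_other[of n d s]
  by (cases "n \<in> d ` \<U> s") auto

text \<open>The position is either the repeated row of \<open>s\<close> or the diagonal row of
  another column of \<open>s\<close>, where column \<open>k\<close> holds a star.\<close>

lemma pos_cached:
  assumes d: "valid_demand d" and s: "s \<in> symbols_of k" and n: "n \<noteq> d k"
  shows "pos s d n \<in> cached_rows k"
proof (cases "n \<in> d ` \<U> s")
  case True
  then obtain k' where k': "k' \<in> \<U> s" "n = d k'" by blast
  then have "P (diag s k') k = None" using diag_star[of s k' k] symbols_ofD[OF s] n by blast
  then show ?thesis using k' symbols_ofD[OF s] diag_less[of s k']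
    by (simp add: pos_demanded[OF d] cached_rows_def)
qed (simp add: pos_other cached_rows_def s)

text \<open>In column \<open>k\<close> a repeated row shows its symbol and the diagonal row of
  another column shows a star, so the two kinds never coincide. Two repeated rows differ in column
  \<open>k\<close>. Two diagonal rows belong to the same requester of \<open>n\<close>, as demands
  are distinct, and differ in that requester's column.\<close>

lemma pos_inj:
  assumes d: "valid_demand d" and n: "n \<noteq> d k"
  shows "inj_on (\<lambda>s. pos s d n) (symbols_of k)"
proof -
  have cross: "pos s d n \<noteq> pos s' d n"
    if s: "s \<in> symbols_of k" "s' \<in> symbols_of k" and n_in: "n \<in> d ` \<U> s" "n \<notin> d ` \<U> s'" for s s'
  proof -
    obtain k' where k': "k' \<in> \<U> s" "n = d k'" using n_in(1) by blast
    then have "P (diag s k') k = None" using diag_star[of s k' k] symbols_ofD[OF s(1)] n by blast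
    moreover have "P (rep s') k = Some s'" using rep_cell symbols_ofD[OF s(2)] by blast
    ultimately show ?thesis using k' pos_demanded[OF d k'(1)] pos_other[OF n_in(2)] by (metis option.distinct(1))
  qed
  show ?thesis
  proof (rule inj_onI)
    fix s s' assume s: "s \<in> symbols_of k" "s' \<in> symbols_of k" and eq: "pos s d n = pos s' d n"
    have iff: "n \<in> d ` \<U> s \<longleftrightarrow> n \<in> d ` \<U> s'" using cross[OF s] cross[OF s(2,1)] eq by metis
    show "s = s'"
    proof (cases "n \<in> d ` \<U> s")
      case True
      then obtain k1 k2 where k: "k1 \<in> \<U> s" "n = d k1" "k2 \<in> \<U> s'" "n = d k2" using iff by blast
      then have "k1 = k2" using valid_demand_eq_iff[OF d, of k1 k2] by (simp add: columns_of_iff)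
      then have "diag s k1 = diag s' k1" using k eq pos_demanded[OF d] by metis
      then show ?thesis
        using k \<open>k1 = k2\<close> symbols_ofD[OF s(1)] symbols_ofD[OF s(2)] by (metis diag_cell option.inject)
    next
      case False
      then have "rep s = rep s'" using iff eq by (simp add: pos_other)
      then show ?thesis using s rep_inj by (simp add: inj_on_def)
    qed
  qed
qed

text \<open>With \<open>pos\<close>, requested and other files are treated alike: whatever the
  demands, each file contributes exactly one packet.\<close>

lemma header_eq:
  assumes "\<omega> \<in> outcomes" "s < S"
  shows "header s \<omega> = (\<U> s, (\<lambda>n. (n, label_of \<omega> n (pos s (demand_of \<omega>) n))) ` {..<N})"
proof -
  let ?d = "demand_of \<omega>"
  have d: "valid_demand ?d" by (rule outcomesD[OF assms(1)])
  have dN: "?d ` \<U> s \<subseteq> {..<N}" using valid_demand_less[OF d] by (auto simp: columns_of_iff)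
  have "{(?d k, label_of \<omega> (?d k) j) | k j. (k, j) \<in> demanded_cells s}
      = (\<lambda>n. (n, label_of \<omega> n (pos s ?d n))) ` (?d ` \<U> s)"
    unfolding demanded_cells_eq[OF assms(2)] using pos_demanded[OF d] by force
  moreover have "{(n, label_of \<omega> n (rep s)) | n. n \<in> other_files s \<omega>}
      = (\<lambda>n. (n, label_of \<omega> n (pos s ?d n))) ` other_files s \<omega>"
    using pos_other[of _ ?d s] by (force simp: other_files_def)
  moreover have "{..<N} = ?d ` \<U> s \<union> other_files s \<omega>" using dN by (auto simp: other_files_def)
  ultimately show ?thesis unfolding header_def by (simp only: image_Un)
qed

lemma X_eq:
  assumes "\<omega> \<in> outcomes" "s < S"
  shows "X s \<omega> = big_xor L {..<N} (\<lambda>n. packet n (pos s (demand_of \<omega>) n) \<omega>)"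
proof -
  let ?d = "demand_of \<omega>"
  let ?f = "\<lambda>n. packet n (pos s ?d n) \<omega>"
  have d: "valid_demand ?d" by (rule outcomesD[OF assms(1)])
  have dN: "?d ` \<U> s \<subseteq> {..<N}" using valid_demand_less[OF d] by (auto simp: columns_of_iff)
  have "big_xor L (demanded_cells s) (\<lambda>(k, j). packet (?d k) j \<omega>)
      = big_xor L (\<U> s) ((\<lambda>(k, j). packet (?d k) j \<omega>) \<circ> (\<lambda>k. (k, diag s k)))"
    unfolding demanded_cells_eq[OF assms(2)] by (rule big_xor_image) (simp add: inj_on_def)
  also have "\<dots> = big_xor L (\<U> s) (?f \<circ> ?d)"
    by (rule big_xor_cong) (simp_all add: pos_demanded[OF d])
  also have "\<dots> = big_xor L (?d ` \<U> s) ?f"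
    by (rule big_xor_image[symmetric]) (rule inj_on_column[OF d])
  finally have 1: "big_xor L (demanded_cells s) (\<lambda>(k, j). packet (?d k) j \<omega>) = big_xor L (?d ` \<U> s) ?f" .
  have 2: "big_xor L (other_files s \<omega>) (\<lambda>n. packet n (rep s) \<omega>) = big_xor L (other_files s \<omega>) ?f"
    by (rule big_xor_cong) (simp_all add: pos_other other_files_def)
  have "xor_bits (big_xor L (?d ` \<U> s) ?f) (big_xor L (other_files s \<omega>) ?f)
      = big_xor L (?d ` \<U> s \<union> other_files s \<omega>) ?f"
    by (rule big_xor_union) (auto simp: other_files_def)
  moreover have "?d ` \<U> s \<union> other_files s \<omega> = {..<N}" using dN by (auto simp: other_files_def)
  ultimately show ?thesis unfolding X_def 1 2 by simp
qed

lemma length_X [simp]: "length (X s \<omega>) = L"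
  by (simp add: X_def)

section \<open>Packets, memory and rate\<close>

lemma packet_offset_less:
  assumes "j < F" "b < L"
  shows "j * L + b < B"
proof -
  have "j * L + b < Suc j * L" using assms(2) by simp
  also have "\<dots> \<le> F * L" using assms(1) by (intro mult_le_mono1) simp
  finally show ?thesis using B_eq by simp
qed

lemma length_packet:
  assumes "\<omega> \<in> outcomes" "n < N" "j < F"
  shows "length (packet n j \<omega>) = L"
proof -
  have "Suc j * L \<le> F * L" using assms(3) by (intro mult_le_mono1) simp
  then have "j * L + L \<le> B" using B_eq by simp
  then show ?thesis using outcomesD(2)[OF assms(1,2)] by (simp add: packet_def)
qed

lemma nth_packet:
  assumes "length (file_of \<omega> n) = B" "j < F" "b < L"
  shows "packet n j \<omega> ! b = file_of \<omega> n ! (j * L + b)"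
  using packet_offset_less[OF assms(2,3)] assms by (simp add: packet_def)

lemma file_eqI:
  assumes "length (file_of \<omega> n) = B" "length (file_of \<omega>' n) = B"
    and eq: "\<And>j. j < F \<Longrightarrow> packet n j \<omega> = packet n j \<omega>'"
  shows "file_of \<omega> n = file_of \<omega>' n"
proof (rule nth_equalityI)
  fix i assume "i < length (file_of \<omega> n)"
  then have i: "i div L < F" "i mod L < L"
    using assms(1) B_eq L_pos by (simp_all add: less_mult_imp_div_less)
  have "file_of \<omega> n ! i = packet n (i div L) \<omega> ! (i mod L)"
    using nth_packet[OF assms(1) i] unfolding div_mult_mod_eq ..
  also have "\<dots> = file_of \<omega>' n ! i"
    unfolding eq[OF i(1)] using nth_packet[OF assms(2) i] unfolding div_mult_mod_eq .
  finally show "file_of \<omega> n ! i = file_of \<omega>' n ! i" .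
qed (use assms in simp)

text \<open>Labels are injective, so packets with equal content do not merge in the cache, which is
  a set.\<close>

lemma labelled_eq_iff:
  assumes "\<omega> \<in> outcomes" "n < N"
  shows "labelled n j \<omega> = labelled n' j' \<omega> \<longleftrightarrow> n = n' \<and> j = j'"
  using permutes_inj[OF outcomesD(3)[OF assms]] by (auto simp: labelled_def inj_def)

text \<open>By \<open>card_symbols_of\<close> each file has \<open>Z + (F - Z) / 2\<close> cached
  packets of \<open>L\<close> bits.\<close>

lemma cache_has_memory:
  "has_memory (real N * (real F + real Z) / (2 * real F))"
  unfolding has_memory_def
proof (intro allI impI ballI)
  fix k \<omega> assume k: "k < K" and w: "\<omega> \<in> outcomes"
  have "inj_on (\<lambda>(n, j). labelled n j \<omega>) ({..<N} \<times> cached_rows k)"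
    using labelled_eq_iff[OF w] by (auto simp: inj_on_def)
  then have "(\<Sum>(n, l, w)\<in>cache k \<omega>. length w)
      = (\<Sum>(n, j)\<in>{..<N} \<times> cached_rows k. length (packet n j \<omega>))"
    unfolding cache_eq[OF k] by (simp add: sum.reindex case_prod_unfold labelled_def)
  also have "\<dots> = (\<Sum>p\<in>{..<N} \<times> cached_rows k. L)"
    using length_packet[OF w] cached_rows_less by (intro sum.cong) auto
  also have "\<dots> = N * (Z + card (symbols_of k)) * L"
    using card_cached_rows[OF k] by (simp add: card_cartesian_product)
  finally have "real (\<Sum>(n, l, w)\<in>cache k \<omega>. length w) = real N * (Z + card (symbols_of k)) * L" by simp
  moreover have "real N * (real F + real Z) / (2 * real F) * real B = real N * ((real F + real Z) / 2) * real L"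
    using arg_cong[OF B_eq, of real] F_pos by simp
  moreover have "(real F + real Z) / 2 = real (Z + card (symbols_of k))"
    using arg_cong[OF card_symbols_of[OF k], of real] by simp
  ultimately show "real (\<Sum>(n, l, w)\<in>cache k \<omega>. length w) = real N * (real F + real Z) / (2 * real F) * real B"
    by (simp only:)
qed

lemma broadcast_has_rate: "has_rate (real S / real F)"
  unfolding has_rate_def
proof
  fix \<omega> assume w: "\<omega> \<in> outcomes"
  have "(\<Sum>s<S. length (broadcast s \<omega>)) = (\<Sum>s<S. L)"
    using outcomesD(4)[OF w] by (intro sum.cong) (simp_all add: broadcast_def)
  moreover have "real B = real F * real L" using B_eq by (metis of_nat_mult)
  ultimately show "real S / real F = real (\<Sum>s<S. length (broadcast s \<omega>)) / real B"
    using L_pos by simp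
qed

section \<open>Decoding\<close>

text \<open>A cache entry shows file and label but no position, so the same entry may sit at another
  position \<open>j'\<close> under \<open>\<omega>'\<close>.\<close>

lemma cached_packet_eq:
  assumes w: "\<omega> \<in> outcomes" "\<omega>' \<in> outcomes" and k: "k < K" and cache: "cache k \<omega> = cache k \<omega>'"
    and n: "n < N" and j: "j \<in> cached_rows k"
  obtains j' where "j' \<in> cached_rows k" "label_of \<omega>' n j' = label_of \<omega> n j" "packet n j' \<omega>' = packet n j \<omega>"
proof -
  have "labelled n j \<omega> \<in> cache k \<omega>" unfolding cache_eq[OF k] using n j by force
  then have "labelled n j \<omega> \<in> cache k \<omega>'" using cache by simp
  then show ?thesis using that unfolding cache_eq[OF k] by (auto simp: labelled_def)
qed

text \<open>
  The index \<open>d\<^sub>k\<close> is not among the conditioning variables: the user recognises it as the only file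
  whose label in a header is missing from the cache.
\<close>

lemma user_decodes:
  assumes w: "\<omega> \<in> outcomes" "\<omega>' \<in> outcomes" and k: "k < K" and cache: "cache k \<omega> = cache k \<omega>'"
    and keys: "user_keys k \<omega> = user_keys k \<omega>'" and received: "received k \<omega> = received k \<omega>'"
    and lab: "label_of \<omega> (demand_of \<omega> k) = label_of \<omega>' (demand_of \<omega>' k)"
  shows "file_of \<omega> (demand_of \<omega> k) = file_of \<omega>' (demand_of \<omega>' k)"
proof -
  define d d' where "d = demand_of \<omega>" and "d' = demand_of \<omega>'"
  have d: "valid_demand d" "valid_demand d'" using outcomesD(1) w by (auto simp: d_def d'_def)
  define n where "n = d k"
  have nN: "n < N" unfolding n_def by (rule valid_demand_less[OF d(1) k])
  have sent: "header s \<omega> = header s \<omega>' \<and> broadcast s \<omega> = broadcast s \<omega>'" if "s \<in> symbols_of k" for s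
    using fun_cong[OF received, of s] that by (simp add: received_def)
  \<comment> \<open>A header contains exactly one label per file, so equal headers mean equal labels
    file by file.\<close>
  have shown: "label_of \<omega> m (pos s d m) = label_of \<omega>' m (pos s d' m)" if "s \<in> symbols_of k" "m < N" for s m
  proof -
    have sS: "s < S" using symbols_ofD[OF that(1)] by simp
    have "(m, label_of \<omega> m (pos s d m)) \<in> snd (header s \<omega>)"
      unfolding header_eq[OF w(1) sS] d_def using that(2) by simp
    then have "(m, label_of \<omega> m (pos s d m)) \<in> snd (header s \<omega>')" using sent[OF that(1)] by simp
    then show ?thesis unfolding header_eq[OF w(2) sS] d'_def by auto
  qed
  have inj: "label_of \<omega> m a = label_of \<omega> m b \<longleftrightarrow> a = b" "label_of \<omega>' m a = label_of \<omega>' m b \<longleftrightarrow> a = b" if "m < N" for m a b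
    using permutes_inj[OF outcomesD(3)[OF w(1) that]] permutes_inj[OF outcomesD(3)[OF w(2) that]]
    by (simp_all only: inj_eq)
  have n': "n = d' k"
  proof (rule ccontr)
    assume "n \<noteq> d' k"
    obtain s where s: "s \<in> symbols_of k" using symbols_of_nonempty[OF k] by blast
    have "pos s d' n \<in> cached_rows k" by (rule pos_cached[OF d(2) s \<open>n \<noteq> d' k\<close>])
    then obtain j where "j \<in> cached_rows k" "label_of \<omega> n j = label_of \<omega>' n (pos s d' n)"
      by (rule cached_packet_eq[OF w(2,1) k cache[symmetric] nN])
    then have "pos s d n \<in> cached_rows k" using shown[OF s nN] inj(1)[OF nN] by metis
    then show False
      using diag_notin_cached_rows[OF s] pos_demanded[OF d(1), of k s] symbols_ofD[OF s] by (simp add: n_def)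
  qed
  have lab: "label_of \<omega> n = label_of \<omega>' n" using lab n' by (simp add: n_def d_def d'_def)
  have "file_of \<omega> n = file_of \<omega>' n"
  proof (rule file_eqI)
    fix j assume "j < F"
    from k this show "packet n j \<omega> = packet n j \<omega>'"
    proof (cases rule: row_cases)
      case 1
      \<comment> \<open>For the requested file the labelling permutation is known, so equal labels
        mean equal positions.\<close>
      obtain j' where "label_of \<omega>' n j' = label_of \<omega> n j" "packet n j' \<omega>' = packet n j \<omega>"
        by (rule cached_packet_eq[OF w k cache nN 1])
      then show ?thesis unfolding lab using inj[OF nN] by simp
    next
      case (2 s)
      note s = symbols_ofD[OF 2(1)]
      have "key_of \<omega> s = key_of \<omega>' s" using fun_cong[OF keys, of s] 2(1) by (simp add: user_keys_def)
      then have "xor_bits (key_of \<omega> s) (X s \<omega>) = xor_bits (key_of \<omega> s) (X s \<omega>')"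
        using conjunct2[OF sent[OF 2(1)]] by (simp only: broadcast_def)
      then have "X s \<omega> = X s \<omega>'"
        by (rule xor_bits_cancel) (use outcomesD(4)[OF w(1)] s in simp_all)
      then have "big_xor L {..<N} (\<lambda>m. packet m (pos s d m) \<omega>) = big_xor L {..<N} (\<lambda>m. packet m (pos s d' m) \<omega>')"
        using X_eq[OF w(1), of s] X_eq[OF w(2), of s] s by (simp add: d_def d'_def)
      \<comment> \<open>The summands of all other files are cached under the labels shown in the
        header and hence agree; what remains of the sum is the packet of \<open>n\<close>.\<close>
      then have "packet n (pos s d n) \<omega> = packet n (pos s d' n) \<omega>'"
      proof (rule big_xor_insert_cancel[rotated 2])
        fix m assume m: "m \<in> {..<N}" "m \<noteq> n"
        have "pos s d m \<in> cached_rows k" using pos_cached[OF d(1) 2(1)] m(2) by (simp add: n_def)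
        then obtain j' where j': "label_of \<omega>' m j' = label_of \<omega> m (pos s d m)" "packet m j' \<omega>' = packet m (pos s d m) \<omega>"
          by (rule cached_packet_eq[OF w k cache lessThan_iff[THEN iffD1, OF m(1)]])
        then have "j' = pos s d' m" using shown[OF 2(1), of m] inj[of m] m(1) by simp
        then show "packet m (pos s d m) \<omega> = packet m (pos s d' m) \<omega>'" using j' by simp
      qed (use nN w s d in \<open>auto intro!: length_packet pos_less\<close>)
      moreover have "pos s d n = diag s k" "pos s d' n = diag s k"
        using pos_demanded[OF d(1), of k s] pos_demanded[OF d(2), of k s] s n' by (simp_all add: n_def)
      ultimately show ?thesis using 2(2) by simp
    qed
  qed (use outcomesD(2) w nN in auto)
  then show ?thesis using n' by (simp add: n_def d_def d'_def)
qed

lemma user_decodable: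
  assumes "k < K"
  shows "decodable k"
  unfolding decodable_def cond_entropy_def prob_model_def
proof (rule uniform_conditional_entropy_0[OF finite_outcomes outcomes_nonempty])
  fix \<omega> \<omega>' assume "\<omega> \<in> outcomes" "\<omega>' \<in> outcomes"
    and "(cache k \<omega>, user_keys k \<omega>, received k \<omega>, label_of \<omega> (demand_of \<omega> k))
      = (cache k \<omega>', user_keys k \<omega>', received k \<omega>', label_of \<omega>' (demand_of \<omega>' k))"
  then show "file_of \<omega> (demand_of \<omega> k) = file_of \<omega>' (demand_of \<omega>' k)"
    unfolding prod.inject by (elim conjE) (rule user_decodes[OF _ _ assms])
qed

section \<open>Privacy by relabelling positions\<close>

definition permute_packets :: "(nat \<Rightarrow> nat) \<Rightarrow> bool list \<Rightarrow> bool list" where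
  "permute_packets \<pi> w = map (\<lambda>i. w ! (\<pi> (i div L) * L + i mod L)) [0..<B]"

text \<open>Moves the labelled packet at position \<open>\<sigma> n j\<close> to position \<open>j\<close> and replaces the demands.\<close>

definition relabel :: "(nat \<Rightarrow> nat \<Rightarrow> nat) \<Rightarrow> (nat \<Rightarrow> nat) \<Rightarrow> outcome \<Rightarrow> outcome" where
  "relabel \<sigma> d \<omega> = Outcome (\<lambda>n\<in>{..<N}. permute_packets (\<sigma> n) (file_of \<omega> n))
     (\<lambda>n\<in>{..<N}. label_of \<omega> n \<circ> \<sigma> n) (key_of \<omega>) d"

lemma packet_relabel:
  assumes "\<omega> \<in> outcomes" "n < N" "j < F" "\<sigma> n permutes {..<F}"
  shows "packet n j (relabel \<sigma> d \<omega>) = packet n (\<sigma> n j) \<omega>"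
proof (rule nth_equalityI)
  have \<sigma>j: "\<sigma> n j < F" using assms(3) permutes_in_image[OF assms(4)] by simp
  have len: "length (file_of (relabel \<sigma> d \<omega>) n) = B" using assms(2) by (simp add: relabel_def permute_packets_def)
  have "Suc j * L \<le> F * L" using assms(3) by (intro mult_le_mono1) simp
  then have lp: "length (packet n j (relabel \<sigma> d \<omega>)) = L" using len B_eq by (simp add: packet_def)
  then show "length (packet n j (relabel \<sigma> d \<omega>)) = length (packet n (\<sigma> n j) \<omega>)"
    using length_packet[OF assms(1,2) \<sigma>j] by simp
  fix b assume "b < length (packet n j (relabel \<sigma> d \<omega>))"
  then have b: "b < L" using lp by simp
  show "packet n j (relabel \<sigma> d \<omega>) ! b = packet n (\<sigma> n j) \<omega> ! b"
    using nth_packet[OF len assms(3) b] nth_packet[OF outcomesD(2)[OF assms(1,2)] \<sigma>j b]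
      packet_offset_less[OF assms(3) b] assms(2) b
    by (simp add: relabel_def permute_packets_def)
qed

lemma labelled_relabel:
  assumes "\<omega> \<in> outcomes" "n < N" "j < F" "\<sigma> n permutes {..<F}"
  shows "labelled n j (relabel \<sigma> d \<omega>) = labelled n (\<sigma> n j) \<omega>"
  using packet_relabel[of \<omega> n j \<sigma> d] assms by (simp add: labelled_def relabel_def)

lemma relabel_in_outcomes:
  assumes "\<omega> \<in> outcomes" "valid_demand d" "\<And>n. n < N \<Longrightarrow> \<sigma> n permutes {..<F}"
  shows "relabel \<sigma> d \<omega> \<in> outcomes"
  using assms by (auto simp: outcomes_def relabel_def valid_demand_def permute_packets_def PiE_iff
    intro: permutes_compose)

text \<open>Rearranging positions is invertible, but \<open>relabel\<close> overwrites the demands,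
  so these have to agree beforehand.\<close>

lemma relabel_inj:
  assumes \<sigma>: "\<And>n. n < N \<Longrightarrow> \<sigma> n permutes {..<F}"
    and w: "\<omega> \<in> outcomes" "\<omega>' \<in> outcomes" and "demand_of \<omega> = demand_of \<omega>'"
    and eq: "relabel \<sigma> d \<omega> = relabel \<sigma> d \<omega>'"
  shows "\<omega> = \<omega>'"
proof -
  have "label_of \<omega> n = label_of \<omega>' n" for n
  proof (cases "n < N")
    case True
    then have "label_of \<omega> n \<circ> \<sigma> n = label_of \<omega>' n \<circ> \<sigma> n"
      using arg_cong[OF eq, of "\<lambda>\<omega>. label_of \<omega> n"] by (simp add: relabel_def)
    then show ?thesis using permutes_surj[OF \<sigma>[OF True]] by (simp add: fun_eq_iff) (metis surjD)
  next
    case False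
    then show ?thesis using w by (auto simp: outcomes_def PiE_iff extensional_def)
  qed
  moreover have "file_of \<omega> n = file_of \<omega>' n" for n
  proof (cases "n < N")
    case True
    show ?thesis
    proof (rule file_eqI)
      fix j assume "j < F"
      then have "j \<in> \<sigma> n ` {..<F}" using permutes_image[OF \<sigma>[OF True]] by simp
      then obtain i where "i < F" "j = \<sigma> n i" by auto
      then show "packet n j \<omega> = packet n j \<omega>'"
        using packet_relabel[of \<omega> n i \<sigma> d] packet_relabel[of \<omega>' n i \<sigma> d] w True \<sigma>[OF True] eq by simp
    qed (use outcomesD(2) w True in auto)
  next
    case False
    then show ?thesis using w by (auto simp: outcomes_def PiE_iff extensional_def)
  qed
  moreover have "key_of \<omega> = key_of \<omega>'" using arg_cong[OF eq, of key_of] by (simp add: relabel_def)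
  ultimately show ?thesis using assms(4) by (intro outcome.expand conjI ext) auto
qed

text \<open>Labels move together with packets, and cached positions are only permuted among
  themselves; the cache as a set does not change.\<close>

lemma relabel_cache:
  assumes w: "\<omega> \<in> outcomes" and k: "k < K"
    and \<sigma>: "\<And>n. n < N \<Longrightarrow> \<sigma> n permutes {..<F}" "\<And>n. n < N \<Longrightarrow> \<sigma> n ` cached_rows k = cached_rows k"
  shows "cache k (relabel \<sigma> d \<omega>) = cache k \<omega>"
proof -
  have "(\<lambda>j. labelled n j (relabel \<sigma> d \<omega>)) ` cached_rows k = (\<lambda>j. labelled n j \<omega>) ` cached_rows k" if "n < N" for n
  proof -
    have "(\<lambda>j. labelled n j (relabel \<sigma> d \<omega>)) ` cached_rows k = (\<lambda>j. labelled n j \<omega>) ` \<sigma> n ` cached_rows k"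
      unfolding image_image
      using labelled_relabel[of \<omega> n _ \<sigma> d] w that \<sigma>(1)[OF that] cached_rows_less by (intro image_cong) auto
    then show ?thesis using \<sigma>(2)[OF that] by simp
  qed
  moreover have "cache k \<omega>' = (\<Union>n<N. (\<lambda>j. labelled n j \<omega>') ` cached_rows k)" for \<omega>'
    unfolding cache_eq[OF k] by auto
  ultimately show ?thesis by simp
qed

text \<open>The position used under \<open>d\<close> receives the labelled packet that was used
  under the old demands, so headers and sums coincide.\<close>

lemma relabel_unmasked:
  assumes w: "\<omega> \<in> outcomes" and d: "valid_demand d"
    and \<sigma>: "\<And>n. n < N \<Longrightarrow> \<sigma> n permutes {..<F}"
    and pos: "\<And>n s. n < N \<Longrightarrow> s \<in> symbols_of k \<Longrightarrow> \<sigma> n (pos s d n) = pos s (demand_of \<omega>) n"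
  shows "unmasked k (relabel \<sigma> d \<omega>) = unmasked k \<omega>"
proof -
  have out: "relabel \<sigma> d \<omega> \<in> outcomes" by (rule relabel_in_outcomes[OF w d \<sigma>])
  have dem: "demand_of (relabel \<sigma> d \<omega>) = d" by (simp add: relabel_def)
  have "header s (relabel \<sigma> d \<omega>) = header s \<omega> \<and> X s (relabel \<sigma> d \<omega>) = X s \<omega>" if s: "s \<in> symbols_of k" for s
  proof
    note sS = conjunct1[OF symbols_ofD[OF s]]
    show "header s (relabel \<sigma> d \<omega>) = header s \<omega>"
      unfolding header_eq[OF w sS] header_eq[OF out sS] dem
      using pos[OF _ s] by (simp add: relabel_def)
    show "X s (relabel \<sigma> d \<omega>) = X s \<omega>"
      unfolding X_eq[OF w sS] X_eq[OF out sS] dem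
      using packet_relabel[of \<omega> _ _ \<sigma> d] w pos_less[OF d sS] \<sigma> pos[OF _ s] by (intro big_xor_cong) auto
  qed
  then show ?thesis unfolding unmasked_def by (intro restrict_ext) simp
qed

text \<open>For a file other than the requested one, \<open>pos_inj\<close> and
  \<open>pos_cached\<close> give two injections into the cached rows, and a permutation matches
  them. For the requested file the positions already agree; the identity is chosen because its
  labels are among the conditioning variables.\<close>

lemma ex_position_permutation:
  assumes d: "valid_demand d0" "valid_demand d1" and k: "k < K" "d0 k = d1 k"
  shows "\<exists>\<pi>. \<pi> permutes {..<F} \<and> \<pi> ` cached_rows k = cached_rows k \<and>
    (\<forall>s\<in>symbols_of k. \<pi> (pos s d1 n) = pos s d0 n) \<and> (n = d0 k \<longrightarrow> \<pi> = id)"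
proof (cases "n = d0 k")
  case True
  have "pos s d1 n = pos s d0 n" if "s \<in> symbols_of k" for s
    using pos_demanded[OF d(1)] pos_demanded[OF d(2)] symbols_ofD[OF that] True k(2) by metis
  then show ?thesis by (intro exI[of _ id]) simp
next
  case False
  have fin: "finite (cached_rows k)" by (rule finite_subset[of _ "{..<F}"]) (auto dest: cached_rows_less)
  obtain \<pi> where \<pi>: "\<pi> permutes cached_rows k" "\<forall>s\<in>symbols_of k. \<pi> (pos s d1 n) = pos s d0 n"
    using ex_permutes_extending[OF fin pos_inj[OF d(2)] pos_inj[OF d(1)], of n k] False k(2)
      pos_cached[OF d(1)] pos_cached[OF d(2)] by (metis image_subsetI)
  moreover have "\<pi> permutes {..<F}"
    by (rule permutes_subset[OF \<pi>(1)]) (auto dest: cached_rows_less)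
  ultimately show ?thesis using permutes_image[OF \<pi>(1)] False by blast
qed

lemma user_demand_private:
  assumes k: "k < K"
  shows "demand_private k"
  unfolding demand_private_def cond_mutual_info_def prob_model_def
proof (rule uniform_conditional_mutual_information_symmetric[OF finite_outcomes outcomes_nonempty])
  let ?U = "\<lambda>\<omega>. restrict (demand_of \<omega>) ({..<K} - {k})"
  let ?T = "\<lambda>\<omega>. (label_of \<omega> (demand_of \<omega> k), cache k \<omega>, demand_of \<omega> k, user_sets k)"
  fix \<omega>0 \<omega>1 assume w: "\<omega>0 \<in> outcomes" "\<omega>1 \<in> outcomes" and T: "?T \<omega>0 = ?T \<omega>1"
  define d0 d1 where "d0 = demand_of \<omega>0" and "d1 = demand_of \<omega>1"
  have d: "valid_demand d0" "valid_demand d1" using outcomesD(1) w by (auto simp: d0_def d1_def)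
  have dk: "d0 k = d1 k" using T by (simp add: d0_def d1_def)
  obtain \<sigma> where \<sigma>: "\<And>n. \<sigma> n permutes {..<F}" "\<And>n. \<sigma> n ` cached_rows k = cached_rows k"
    "\<And>n s. s \<in> symbols_of k \<Longrightarrow> \<sigma> n (pos s d1 n) = pos s d0 n" "\<sigma> (d0 k) = id"
    using ex_position_permutation[OF d k dk] by metis
  \<comment> \<open>\<open>?T\<close> contains the demand of user \<open>k\<close>, so
    \<open>?U\<close> and \<open>?T\<close> together fix the whole demand vector, and the same
    \<open>\<sigma>\<close> serves the entire fibre.\<close>
  have same: "demand_of \<omega> = d0" if "\<omega> \<in> outcomes" "?U \<omega> = ?U \<omega>0" "?T \<omega> = ?T \<omega>0" for \<omega>
  proof
    fix i
    show "demand_of \<omega> i = d0 i"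
    proof (cases "i < K \<and> i \<noteq> k")
      case True
      then show ?thesis using fun_cong[OF that(2), of i] by (simp add: d0_def)
    next
      case False
      then show ?thesis using that w(1) by (auto simp: outcomes_def PiE_iff extensional_def d0_def)
    qed
  qed
  show "\<exists>h. inj_on h {\<omega> \<in> outcomes. ?U \<omega> = ?U \<omega>0 \<and> ?T \<omega> = ?T \<omega>0} \<and>
      (\<forall>\<omega>\<in>outcomes. ?U \<omega> = ?U \<omega>0 \<and> ?T \<omega> = ?T \<omega>0 \<longrightarrow>
        h \<omega> \<in> outcomes \<and> ?U (h \<omega>) = ?U \<omega>1 \<and> unmasked k (h \<omega>) = unmasked k \<omega> \<and> ?T (h \<omega>) = ?T \<omega>)"
  proof (intro exI[of _ "relabel \<sigma> d1"] conjI ballI impI)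
    show "inj_on (relabel \<sigma> d1) {\<omega> \<in> outcomes. ?U \<omega> = ?U \<omega>0 \<and> ?T \<omega> = ?T \<omega>0}"
    proof (rule inj_onI)
      fix \<omega> \<omega>' assume "\<omega> \<in> {\<omega> \<in> outcomes. ?U \<omega> = ?U \<omega>0 \<and> ?T \<omega> = ?T \<omega>0}"
        and "\<omega>' \<in> {\<omega> \<in> outcomes. ?U \<omega> = ?U \<omega>0 \<and> ?T \<omega> = ?T \<omega>0}"
        and eq: "relabel \<sigma> d1 \<omega> = relabel \<sigma> d1 \<omega>'"
      then have "\<omega> \<in> outcomes" "\<omega>' \<in> outcomes" "demand_of \<omega> = d0" "demand_of \<omega>' = d0"
        using same by blast+
      then show "\<omega> = \<omega>'" using eq \<sigma>(1) by (intro relabel_inj[of \<sigma> \<omega> \<omega>' d1]) simp_all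
    qed
  next
    fix \<omega> assume \<omega>: "\<omega> \<in> outcomes" "?U \<omega> = ?U \<omega>0 \<and> ?T \<omega> = ?T \<omega>0"
    then have dem: "demand_of \<omega> = d0" using same by blast
    have dem': "demand_of (relabel \<sigma> d1 \<omega>) = d1" by (simp add: relabel_def)
    show "relabel \<sigma> d1 \<omega> \<in> outcomes" by (rule relabel_in_outcomes[OF \<omega>(1) d(2) \<sigma>(1)])
    show "?U (relabel \<sigma> d1 \<omega>) = ?U \<omega>1" unfolding dem' unfolding d1_def ..
    show "unmasked k (relabel \<sigma> d1 \<omega>) = unmasked k \<omega>"
      by (rule relabel_unmasked[OF \<omega>(1) d(2) \<sigma>(1)]) (simp add: \<sigma>(3) dem)
    have "cache k (relabel \<sigma> d1 \<omega>) = cache k \<omega>" by (rule relabel_cache[OF \<omega>(1) k \<sigma>(1,2)])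
    moreover have "label_of (relabel \<sigma> d1 \<omega>) (d0 k) = label_of \<omega> (d0 k)"
      using valid_demand_less[OF d(1) k] \<sigma>(4) by (simp add: relabel_def)
    ultimately show "?T (relabel \<sigma> d1 \<omega>) = ?T \<omega>" by (simp add: dem dem' dk)
  qed
qed

theorem spda_scheme:
  "secure_coded_caching_scheme (real N * (real F + real Z) / (2 * real F))"
  unfolding secure_coded_caching_scheme_def
  using cache_has_memory user_decodable user_demand_private by blast

end

section \<open>Parameters of the resulting scheme\<close>

theorem theorem3:
  fixes K t :: nat
  assumes "0 < K" and "0 < t" and "(t + 1) dvd K"
  shows "\<exists>F P.
    real F = (2 * real K - real t) / (real K - real t) * real ((K - 1) choose t) \<and>
    optimal_spda K F ((K - 1) choose (t - 1)) (K choose (t + 1)) P \<and>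
    (\<forall>N B. K \<le> N \<and> 0 < B \<and> F dvd B \<longrightarrow>
      (\<exists>M R.
        array_caching.secure_coded_caching_scheme K F (K choose (t + 1)) N B P M \<and>
        array_caching.has_rate K F (K choose (t + 1)) N B P R \<and>
        M / real N = real K / (2 * real K - real t) \<and>
        R = (real K - real t) / (real t + 1) * (real K / (2 * real K - real t))))"
proof -
  have tK: "t < K" using dvd_imp_le[OF assms(3,1)] by simp
  define c Z F S where "c = (K - 1) choose t" and "Z = (K - 1) choose (t - 1)"
    and "F = (K choose t) + c" and "S = K choose (t + 1)"
  obtain P where P: "optimal_spda K F Z S P"
    using ex_optimal_spda[OF assms(2) tK assms(3)] unfolding F_def c_def Z_def S_def by blast
  \<comment> \<open>Hence \<open>F = Z + 2 * c\<close>. This gives \<open>Z < F\<close> for the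
    locale and, in \<open>FZ\<close> below, \<open>F + Z = 2 * (K choose t)\<close>.\<close>
  have pascal: "K choose t = Z + c"
    using assms(1,2) choose_reduce_nat[of K t] by (simp add: Z_def c_def)
  have c_pos: "0 < c" using tK by (simp add: c_def)
  note ids = choose_identities[OF assms(2) tK, folded c_def Z_def S_def]
  have pos: "0 < real K - real t" "real (K - t) = real K - real t" "0 < 2 * real K - real t" using tK by auto
  have Kt: "real (K choose t) = real K * c / (real K - real t)"
    using ids(2) pos by (simp add: field_simps)
  have F: "real F = (2 * real K - real t) / (real K - real t) * c"
    using Kt pos by (simp add: F_def field_simps)
  have FZ: "real F + real Z = 2 * real (K choose t)" by (simp add: F_def pascal)
  have mem: "(real F + real Z) / (2 * real F) = real K / (2 * real K - real t)"
  proof -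
    have "(real F + real Z) / (2 * real F) = real (K choose t) / real F" unfolding FZ by simp
    also have "\<dots> = (real K * c / (real K - real t)) / ((2 * real K - real t) / (real K - real t) * c)"
      unfolding F Kt ..
    also have "\<dots> = real K / (2 * real K - real t)" using pos c_pos by simp
    finally show ?thesis .
  qed
  have S: "real S = real K * c / (real t + 1)"
    using ids(3) by (simp add: field_simps)
  have rate: "real S / real F = (real K - real t) / (real t + 1) * (real K / (2 * real K - real t))"
    unfolding F S using pos c_pos by simp
  have "\<exists>M R. array_caching.secure_coded_caching_scheme K F S N B P M \<and> array_caching.has_rate K F S N B P R \<and>
      M / real N = real K / (2 * real K - real t) \<and>
      R = (real K - real t) / (real t + 1) * (real K / (2 * real K - real t))"
    if "K \<le> N \<and> 0 < B \<and> F dvd B" for N B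
  proof -
    interpret spda_caching K F S N B P Z
      using that P c_pos by unfold_locales (auto simp: optimal_spda_def F_def pascal)
    have "real N * (real F + real Z) / (2 * real F) / real N = real K / (2 * real K - real t)"
      using mem that assms(1) by simp
    then show ?thesis using spda_scheme broadcast_has_rate rate by blast
  qed
  then show ?thesis using F P unfolding c_def Z_def S_def by blast
qed

end
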